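(* Let $G$ be a free group, let $G$ act by measure preserving bijections on a standard probability space $(X,\mu)$, and let $H\leq G$ be a subgroup of finite index, acting on $(X,\mu)$ by restriction. If $G\curvearrowright(X,\mu)$ is a Markov process with a Markov partition having finite Shannon entropy, then $H\curvearrowright(X,\mu)$ is also a Markov process. In fact, if $G\curvearrowright(X,\mu)$ is an $(S,\alpha)$-Markov process with $\mathrm{H}(\alpha)<\infty$ and $\Delta\subseteq G$ is any right $S$-connected transversal of the right $H$-cosets $\{Hg : g\in G\}$ with $1_G\in\Delta$, then there exists a free generating set $T$ for $H$ such that $H\curvearrowright(X,\mu)$ is a $(T,\Delta\cdot\alpha)$-Markov process.
   Context: All groups are countable (free groups need not be finitely generated). The Shannon entropy of a countable measurable partition is $\mathrm{H}(\alpha)=\sum_{A\in\alpha}-\mu(A)\log\mu(A)$. For a partition $\alpha$, $g\cdot\alpha=\{g\cdot A: A\in\alpha\}$; for $F\subseteq G$, $F\cdot\alpha=\bigvee_{f\in F}f\cdot\alpha$, which is the join of partitions for finite $F$ and denotes the $\sigma$-algebra generated by the sets in all the $f\cdot\alpha$ for infinite $F$. A countable measurable partition $\alpha$ is generating for $G$ if $G\cdot\alpha$ contains every measurable set up to null sets. A transversal of the right $H$-cosets is a set meeting each $Hg$ in exactly one point. Let $S$ be a free generating set of $G$. The right $S$-Cayley graph of $G$ is the tree with vertex set $G$ and edges $(g,gs)$, $g\in G$, $s\in S\cup S^{-1}$. A set $\Delta\subseteq G$ is right $S$-connected if for any two of its elements the unique non-self-intersecting path between them in this tree stays in $\Delta$.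 For $s\in S\cup S^{-1}$, $\mathrm{RPast}_S(1_G,s)$ is the set of $g\in G$ such that the path from $g$ to $s$ passes through $1_G$ (equivalently, the reduced $S$-word of $g$ does not begin on the left with $s$). Markov process: a measure preserving action of $G$ on $(X,\mu)$ is an $(S,\alpha)$-Markov process, where $\alpha$ is a countable measurable partition, if $\alpha$ is generating and for every $A\in\alpha$, $s\in S\cup S^{-1}$ and $\mu$-a.e. $x\in X$, $$\mathbb{E}\big(\chi_{s\cdot A}\mid \mathrm{RPast}_S(1_G,s)\cdot\alpha\big)(x)=\mathbb{E}(\chi_{s\cdot A}\mid\alpha)(x).$$ It is a Markov process if this holds for some free generating set $S$ of $G$ and some $\alpha$; such an $\alpha$ is called a Markov partition. *)

theory Defs
  imports
    "HOL-Algebra.Group_Action"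
    "HOL-Algebra.Generated_Groups"
    "HOL-Probability.Conditional_Expectation"
begin

text \<open>A word is a list of letters; \<open>(s, True)\<close> stands for \<open>s\<close> and \<open>(s, False)\<close> for its formal
  inverse.\<close>

definition reduced_word :: "'g set \<Rightarrow> ('g \<times> bool) list \<Rightarrow> bool" where
  "reduced_word S w \<longleftrightarrow>
     fst ` set w \<subseteq> S \<and>
     successively (\<lambda>(s, a) (t, b). \<not> (s = t \<and> a \<noteq> b)) w"

definition word_value :: "('g, 'm) monoid_scheme \<Rightarrow> ('g \<times> bool) list \<Rightarrow> 'g" where
  "word_value G w =
     foldr (\<lambda>(s, a) g. (if a then s else inv\<^bsub>G\<^esub> s) \<otimes>\<^bsub>G\<^esub> g) w \<one>\<^bsub>G\<^esub>"

definition free_generating_set :: "('g, 'm) monoid_scheme \<Rightarrow> 'g set \<Rightarrow> bool" where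
  "free_generating_set G S \<longleftrightarrow>
     S \<subseteq> carrier G \<and> generate G S = carrier G \<and>
     (\<forall>w. reduced_word S w \<and> w \<noteq> [] \<longrightarrow> word_value G w \<noteq> \<one>\<^bsub>G\<^esub>)"

definition free_group :: "('g, 'm) monoid_scheme \<Rightarrow> bool" where
  "free_group G \<longleftrightarrow> group G \<and> (\<exists>S. free_generating_set G S)"

definition right_cayley_adj :: "('g, 'm) monoid_scheme \<Rightarrow> 'g set \<Rightarrow> 'g \<Rightarrow> 'g \<Rightarrow> bool" where
  "right_cayley_adj G S g h \<longleftrightarrow> (\<exists>s \<in> S \<union> set_inv\<^bsub>G\<^esub> S. h = g \<otimes>\<^bsub>G\<^esub> s)"

definition right_cayley_path ::
  "('g, 'm) monoid_scheme \<Rightarrow> 'g set \<Rightarrow> 'g \<Rightarrow> 'g list \<Rightarrow> 'g \<Rightarrow> bool" where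
  "right_cayley_path G S g p h \<longleftrightarrow>
     p \<noteq> [] \<and> hd p = g \<and> last p = h \<and> set p \<subseteq> carrier G \<and> distinct p \<and>
     successively (right_cayley_adj G S) p"

text \<open>In the next two definitions \<open>S\<close> is a free generating set, so that the Cayley graph is a tree
  and the universally quantified path is the unique non-self-intersecting one.\<close>

definition right_connected :: "('g, 'm) monoid_scheme \<Rightarrow> 'g set \<Rightarrow> 'g set \<Rightarrow> bool" where
  "right_connected G S D \<longleftrightarrow>
     (\<forall>g\<in>D. \<forall>h\<in>D. \<forall>p. right_cayley_path G S g p h \<longrightarrow> set p \<subseteq> D)"

definition RPast :: "('g, 'm) monoid_scheme \<Rightarrow> 'g set \<Rightarrow> 'g \<Rightarrow> 'g set" where
  "RPast G S s =
     {g \<in> carrier G. \<forall>p. right_cayley_path G S g p s \<longrightarrow> \<one>\<^bsub>G\<^esub> \<in> set p}"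

definition right_transversal :: "('g, 'm) monoid_scheme \<Rightarrow> 'g set \<Rightarrow> 'g set \<Rightarrow> bool" where
  "right_transversal G H D \<longleftrightarrow>
     D \<subseteq> carrier G \<and> (\<forall>C \<in> rcosets\<^bsub>G\<^esub> H. \<exists>!d. d \<in> D \<inter> C)"

definition standard_probability_space :: "'x measure \<Rightarrow> bool" where
  "standard_probability_space M \<longleftrightarrow> prob_space M \<and>
     (\<exists>T. topspace T = space M \<and> completely_metrizable_space T \<and> second_countable T \<and>
          sets M = sigma_sets (space M) {U. openin T U})"

definition pmp_action ::
  "('g, 'm) monoid_scheme \<Rightarrow> 'x measure \<Rightarrow> ('g \<Rightarrow> 'x \<Rightarrow> 'x) \<Rightarrow> bool" where
  "pmp_action G M \<phi> \<longleftrightarrow> group_action G (space M) \<phi> \<and>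
     (\<forall>g \<in> carrier G. \<phi> g \<in> measurable M M \<and> distr M M (\<phi> g) = M)"

definition countable_partition :: "'x measure \<Rightarrow> 'x set set \<Rightarrow> bool" where
  "countable_partition M \<alpha> \<longleftrightarrow> partition_on (space M) \<alpha> \<and> countable \<alpha> \<and> \<alpha> \<subseteq> sets M"

text \<open>All summands are nonnegative in a probability space, hence the sum may be taken in
  \<open>ennreal\<close>; \<open>ln 0 = 0\<close> gives the usual convention for null pieces.\<close>

definition shannon_entropy :: "'x measure \<Rightarrow> 'x set set \<Rightarrow> ennreal" where
  "shannon_entropy M \<alpha> = (\<Sum>\<^sub>\<infinity>A\<in>\<alpha>. ennreal (- measure M A * ln (measure M A)))"

definition translate :: "('g \<Rightarrow> 'x \<Rightarrow> 'x) \<Rightarrow> 'g \<Rightarrow> 'x set set \<Rightarrow> 'x set set" where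
  "translate \<phi> g \<alpha> = (\<lambda>A. \<phi> g ` A) ` \<alpha>"

text \<open>The two readings of \<open>F \<cdot> \<alpha>\<close>: the join of partitions (for finite nonempty \<open>F\<close>), and the
  generated \<open>\<sigma>\<close>-algebra.\<close>

definition join_partition :: "('g \<Rightarrow> 'x \<Rightarrow> 'x) \<Rightarrow> 'g set \<Rightarrow> 'x set set \<Rightarrow> 'x set set" where
  "join_partition \<phi> F \<alpha> = common_refinement ((\<lambda>f. translate \<phi> f \<alpha>) ` F)"

definition join_algebra ::
  "'x measure \<Rightarrow> ('g \<Rightarrow> 'x \<Rightarrow> 'x) \<Rightarrow> 'g set \<Rightarrow> 'x set set \<Rightarrow> 'x measure" where
  "join_algebra M \<phi> F \<alpha> = sigma (space M) (\<Union>f\<in>F. translate \<phi> f \<alpha>)"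

definition generating_partition ::
  "('g, 'm) monoid_scheme \<Rightarrow> 'x measure \<Rightarrow> ('g \<Rightarrow> 'x \<Rightarrow> 'x) \<Rightarrow> 'x set set \<Rightarrow> bool" where
  "generating_partition G M \<phi> \<alpha> \<longleftrightarrow>
     (\<forall>B \<in> sets M. \<exists>C \<in> sets (join_algebra M \<phi> (carrier G) \<alpha>).
        (B - C) \<union> (C - B) \<in> null_sets M)"

definition markov_process_wrt ::
  "('g, 'm) monoid_scheme \<Rightarrow> 'x measure \<Rightarrow> ('g \<Rightarrow> 'x \<Rightarrow> 'x) \<Rightarrow> 'g set \<Rightarrow> 'x set set \<Rightarrow> bool" where
  "markov_process_wrt G M \<phi> S \<alpha> \<longleftrightarrow>
     pmp_action G M \<phi> \<and> free_generating_set G S \<and>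
     countable_partition M \<alpha> \<and> generating_partition G M \<phi> \<alpha> \<and>
     (\<forall>A \<in> \<alpha>. \<forall>s \<in> S \<union> set_inv\<^bsub>G\<^esub> S. AE x in M.
        real_cond_exp M (join_algebra M \<phi> (RPast G S s) \<alpha>) (indicat_real (\<phi> s ` A)) x =
        real_cond_exp M (sigma (space M) \<alpha>) (indicat_real (\<phi> s ` A)) x)"

definition markov_process ::
  "('g, 'm) monoid_scheme \<Rightarrow> 'x measure \<Rightarrow> ('g \<Rightarrow> 'x \<Rightarrow> 'x) \<Rightarrow> bool" where
  "markov_process G M \<phi> \<longleftrightarrow> (\<exists>S \<alpha>. markov_process_wrt G M \<phi> S \<alpha>)"

end

theory Submission
  imports Defs
begin

text \<open>Writing \<open>G\<close> as the disjoint union of the connected blocks \<open>h\<Delta>\<close> (\<open>h \<in> H\<close>) and contracting each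
  block turns the Cayley tree of \<open>G\<close> into a tree on which \<open>H\<close> acts simply transitively. For each
  neighbouring block \<open>u\<Delta>\<close> of \<open>\<Delta>\<close> there is exactly one edge from \<open>\<Delta>\<close> to \<open>u\<Delta>\<close>, and one
  element of each pair \<open>u, u\<inverse>\<close> of such \<open>u\<close> gives the basis \<open>T\<close>. The Markov property says that
  across any edge \<open>(a, b)\<close> of the tree the two sides are independent given \<open>a\<alpha>\<close>; applied to the
  edge from \<open>\<Delta>\<close> to \<open>t\<Delta>\<close>, it gives the Markov property of \<open>\<Delta>\<alpha>\<close> with respect to \<open>T\<close>.\<close>

section \<open>Reachability and trees\<close>

text \<open>The contracted tree is never built as a graph of its own. It is read off from the map
  \<open>proj\<close>, which sends a vertex to the \<open>h\<close> of its block, and from the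
  half-trees \<open>beyond a b\<close> of the Cayley tree; freeness of \<open>T\<close> is a
  ping-pong on these half-trees. Choosing one of \<open>u\<close> and \<open>inv u\<close>
  presupposes that they differ: an involution would flip its only edge, which a free basis excludes.
  On the measure side the obstacle is that \<Delta>\<alpha> is finer than a\<alpha>. Conditional
  expectations are replaced by identities \<mu>(W \<inter> A \<inter> B) \<mu>(A) = \<mu>(W \<inter>
  A) \<mu>(A \<inter> B) for pieces A and past events W. A piece C of \<Delta>\<alpha> lies inside
  one piece of a\<alpha> and is itself a past event, so the identity for a\<alpha>, used for W
  \<inter> C and for C alone, gives by division the identity for \<Delta>\<alpha>. Null pieces are
  treated apart. Finite index makes \<Delta> finite, which keeps \<Delta>\<alpha> countable.\<close>

definition reach :: "('v \<Rightarrow> 'v \<Rightarrow> bool) \<Rightarrow> 'v set \<Rightarrow> 'v \<Rightarrow> 'v \<Rightarrow> bool" where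
  "reach R C = (\<lambda>x y. R x y \<and> x \<in> C \<and> y \<in> C)\<^sup>*\<^sup>*"

lemma reach_refl [simp]: "reach R C x x"
  by (simp add: reach_def)

lemma reach_trans: "reach R C x y \<Longrightarrow> reach R C y z \<Longrightarrow> reach R C x z"
  by (simp add: reach_def)

lemma reach_edge: "R x y \<Longrightarrow> x \<in> C \<Longrightarrow> y \<in> C \<Longrightarrow> reach R C x y"
  by (auto simp: reach_def)

lemma reach_mono:
  assumes "reach R C x y" "C \<subseteq> D"
  shows "reach R D x y"
  using assms(1) unfolding reach_def
  by (rule rtranclp_mono[THEN predicate2D, rotated]) (use assms(2) in auto)

lemma reach_sym:
  assumes "\<And>x y. R x y \<Longrightarrow> R y x" and "reach R C x y"
  shows "reach R C y x"
  using assms(2) unfolding reach_def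
  by (induction rule: rtranclp_induct)
     (use assms(1) in \<open>auto intro: converse_rtranclp_into_rtranclp\<close>)

lemma reach_mem: "reach R C x y \<Longrightarrow> x \<in> C \<Longrightarrow> y \<in> C"
  unfolding reach_def by (induction rule: rtranclp_induct) auto

lemma reach_map:
  assumes "reach R C x y"
    and "\<And>u v. R u v \<Longrightarrow> u \<in> C \<Longrightarrow> v \<in> C \<Longrightarrow> reach R' C' (f u) (f v)"
  shows "reach R' C' (f x) (f y)"
  using assms(1) unfolding reach_def[of R]
  by (induction rule: rtranclp_induct) (auto intro: reach_trans assms(2))

lemma reach_invariant:
  assumes "reach R C x y" "P x"
    and "\<And>u v. R u v \<Longrightarrow> u \<in> C \<Longrightarrow> v \<in> C \<Longrightarrow> P u \<Longrightarrow> P v"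
  shows "P y"
  using assms(1) unfolding reach_def by (induction rule: rtranclp_induct) (use assms in auto)

text \<open>Links the closure to the vertex lists of \<open>right_cayley_path\<close>; loops of a
  walk are cut out. Since \<open>reach\<close> is reflexive even outside \<open>C\<close>, the
  trivial walk forces the assumption on \<open>x\<close>.\<close>

lemma reach_iff_path:
  assumes "x \<in> C"
  shows "reach R C x y \<longleftrightarrow>
    (\<exists>p. p \<noteq> [] \<and> hd p = x \<and> last p = y \<and> set p \<subseteq> C \<and> distinct p \<and> successively R p)"
    (is "_ \<longleftrightarrow> (\<exists>p. ?path x p)")
proof
  assume "reach R C x y"
  then show "\<exists>p. ?path x p" using assms unfolding reach_def
  proof (induction rule: converse_rtranclp_induct)
    case base
    then show ?case by (intro exI[of _ "[y]"]) auto
  next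
    case (step x z)
    then obtain p where p: "?path z p" by auto
    show ?case
    proof (cases "x \<in> set p")
      case True
      \<comment> \<open>The new vertex already lies on the path, so the suffix starting there is a
        path from it.\<close>
      then obtain us vs where "p = us @ x # vs" by (auto simp: in_set_conv_decomp)
      with p show ?thesis
        by (intro exI[of _ "x # vs"]) (auto simp: successively_append_iff)
    next
      case False
      with p step show ?thesis
        by (intro exI[of _ "x # p"]) (auto simp: successively_Cons)
    qed
  qed
next
  assume "\<exists>p. ?path x p"
  then obtain p where "?path x p" by blast
  then show "reach R C x y"
  proof (induction p arbitrary: x)
    case (Cons a p)
    show ?case
    proof (cases "p = []")
      case False
      with Cons have "reach R C (hd p) y" by (auto simp: successively_Cons)
      moreover have "reach R C a (hd p)"
        using Cons False by (intro reach_edge) (auto simp: successively_Cons)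
      ultimately show ?thesis using Cons by (auto intro: reach_trans)
    qed (use Cons in auto)
  qed simp
qed

text \<open>Among the connected subsets of \<open>D\<close> that contain \<open>a\<close> and
  satisfy \<open>P\<close>, take one of largest cardinality. If it misses a vertex of
  \<open>D\<close>, a walk in \<open>D\<close> from \<open>a\<close> to that vertex leaves it across
  some edge, and adding the far end contradicts maximality.\<close>

lemma finite_connected_induct:
  assumes "finite D" "a \<in> D" and D: "\<And>x. x \<in> D \<Longrightarrow> reach R D a x"
    and base: "P {a}"
    and step: "\<And>E g h. a \<in> E \<Longrightarrow> E \<subseteq> D \<Longrightarrow> (\<And>x. x \<in> E \<Longrightarrow> reach R E a x) \<Longrightarrow> P E \<Longrightarrow>
      g \<in> E \<Longrightarrow> h \<in> D - E \<Longrightarrow> R g h \<Longrightarrow> P (insert h E)"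
  shows "P D"
proof -
  define Q where "Q E \<longleftrightarrow> a \<in> E \<and> E \<subseteq> D \<and> (\<forall>x\<in>E. reach R E a x) \<and> P E" for E
  have "Q {a}" using assms by (auto simp: Q_def)
  then obtain E where E: "Q E" and max: "\<And>E'. Q E' \<Longrightarrow> card E' \<le> card E"
    using ex_has_greatest_nat[of Q "{a}" card "Suc (card D)"] card_mono[OF \<open>finite D\<close>]
    by (auto simp: Q_def less_Suc_eq_le)
  have fin: "finite E" using E \<open>finite D\<close> by (auto simp: Q_def intro: finite_subset)
  have "E = D"
  proof (rule ccontr)
    assume "E \<noteq> D"
    then obtain x where x: "x \<in> D" "x \<notin> E" using E by (auto simp: Q_def)
    have "\<exists>g h. g \<in> E \<and> h \<in> D - E \<and> R g h"
    proof (rule ccontr)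
      assume "\<nexists>g h. g \<in> E \<and> h \<in> D - E \<and> R g h"
      then have "x \<in> E"
        using reach_invariant[OF D[OF x(1)], of "\<lambda>x. x \<in> E"] E by (auto simp: Q_def)
      with x show False by simp
    qed
    then obtain g h where gh: "g \<in> E" "h \<in> D - E" "R g h" by blast
    have "reach R (insert h E) a x" if "x \<in> insert h E" for x
    proof (cases "x = h")
      case True
      have "reach R (insert h E) a g"
        using gh E by (auto simp: Q_def intro: reach_mono)
      moreover have "reach R (insert h E) g h" using gh by (intro reach_edge) auto
      ultimately show ?thesis using True reach_trans by metis
    qed (use that E in \<open>auto simp: Q_def intro: reach_mono\<close>)
    then have "Q (insert h E)" using gh E step[of E g h] by (auto simp: Q_def)
    from max[OF this] show False using gh fin by auto
  qed
  with E show ?thesis by (simp add: Q_def)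
qed

section \<open>Trees and the half-trees behind their edges\<close>

locale tree_graph =
  fixes V :: "'v set" and adj :: "'v \<Rightarrow> 'v \<Rightarrow> bool"
  assumes adj_in: "adj a b \<Longrightarrow> a \<in> V"
    and adj_sym: "adj a b \<Longrightarrow> adj b a"
    and adj_irrefl: "\<not> adj a a"
    and reach_all: "a \<in> V \<Longrightarrow> b \<in> V \<Longrightarrow> reach adj V a b"
    and acyclic: "adj a b \<Longrightarrow> adj a c \<Longrightarrow> reach adj (V - {a}) b c \<Longrightarrow> b = c"
begin

text \<open>The component of \<open>b\<close> after \<open>a\<close> is deleted. By
  \<open>acyclic\<close>, distinct neighbours of \<open>a\<close> have distinct components, so for
  an edge this is the half-tree on the side of \<open>b\<close>.\<close>

definition beyond :: "'v \<Rightarrow> 'v \<Rightarrow> 'v set" where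
  "beyond a b = {x \<in> V. reach adj (V - {a}) x b}"

lemma beyond_subset: "beyond a b \<subseteq> V"
  by (auto simp: beyond_def)

lemma adj_in2: "adj a b \<Longrightarrow> b \<in> V"
  using adj_in adj_sym by blast

lemma reach_commute: "reach adj C x y \<Longrightarrow> reach adj C y x"
  by (erule reach_sym[rotated]) (rule adj_sym)

lemma end_in_beyond: "adj a b \<Longrightarrow> b \<in> beyond a b"
  by (auto simp: beyond_def adj_in2)

lemma start_notin_beyond:
  assumes "adj a b"
  shows "a \<notin> beyond a b"
proof
  assume "a \<in> beyond a b"
  then have "reach adj (V - {a}) b a" by (auto simp: beyond_def intro: reach_commute)
  then have "a \<in> V - {a}"
    by (rule reach_mem) (use assms adj_irrefl adj_in2 in auto)
  then show False by simp
qed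

text \<open>Components of the graph without \<open>a\<close> are closed under adjacency, so such a
  branch can only be entered from \<open>a\<close>; \<open>acyclic\<close> leaves \<open>b\<close>
  as the only way in. All later separation arguments rest on this.\<close>

lemma crossing_edge:
  assumes "adj a b" "adj x y" "x \<notin> beyond a b" "y \<in> beyond a b"
  shows "x = a \<and> y = b"
proof -
  have yr: "reach adj (V - {a}) y b" and "y \<in> V" using assms by (auto simp: beyond_def)
  have "y \<noteq> a" using assms start_notin_beyond by blast
  have "x = a"
  proof (rule ccontr)
    assume "x \<noteq> a"
    then have "reach adj (V - {a}) x y"
      using assms adj_in adj_in2 \<open>y \<noteq> a\<close> by (intro reach_edge) auto
    then have "x \<in> beyond a b" using yr assms adj_in by (auto simp: beyond_def intro: reach_trans)
    with assms show False by simp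
  qed
  moreover have "y = b" using acyclic[of a y b] assms yr \<open>x = a\<close> by simp
  ultimately show ?thesis by simp
qed

lemma reach_in_beyond:
  assumes "adj a b" "x \<in> beyond a b"
  shows "reach adj (beyond a b) b x"
proof -
  have "reach adj (V - {a}) b x"
    using assms by (auto simp: beyond_def intro: reach_commute)
  then have "reach adj (beyond a b) b x \<and> x \<in> beyond a b"
  proof (rule reach_invariant)
    fix u v
    assume uv: "adj u v" "u \<in> V - {a}" "v \<in> V - {a}"
      and u: "reach adj (beyond a b) b u \<and> u \<in> beyond a b"
    have "v \<in> beyond a b" using crossing_edge[OF assms(1), of v u] uv u adj_sym by auto
    with u uv show "reach adj (beyond a b) b v \<and> v \<in> beyond a b"
      by (auto intro: reach_trans reach_edge)
  qed (use assms end_in_beyond in auto)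
  then show ?thesis by simp
qed

text \<open>The only entrance to the branch is the step from \<open>g\<close> to \<open>h\<close>,
  and a walk inside \<open>C\<close> cannot use \<open>h\<close>.\<close>

lemma disjoint_beyond:
  assumes "adj g h" "h \<notin> C" "reach adj C g x"
  shows "x \<notin> beyond g h"
  using assms(3)
proof (rule reach_invariant)
  show "g \<notin> beyond g h" using assms start_notin_beyond by simp
  fix u v
  assume "adj u v" "u \<in> C" "v \<in> C" "u \<notin> beyond g h"
  then show "v \<notin> beyond g h" using crossing_edge[OF assms(1), of u v] assms(2) by auto
qed

text \<open>Along a walk from \<open>a\<close>, membership in either branch changes only when the
  edge between \<open>a\<close> and \<open>b\<close> is crossed, and then both memberships change.
  So the two branches stay complementary.\<close>

lemma beyond_swap:
  assumes "adj a b"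
  shows "V - beyond a b = beyond b a"
proof -
  have ba: "adj b a" using assms adj_sym by simp
  have "(x \<in> beyond a b) \<longleftrightarrow> \<not> (x \<in> beyond b a)" if "x \<in> V" for x
  proof (rule reach_invariant[of adj V a x])
    show "reach adj V a x" using reach_all adj_in that assms by blast
    show "(a \<in> beyond a b) \<longleftrightarrow> \<not> (a \<in> beyond b a)"
      using end_in_beyond[OF ba] start_notin_beyond[OF assms] by simp
    fix u v
    assume uv: "adj u v" and u: "(u \<in> beyond a b) \<longleftrightarrow> \<not> (u \<in> beyond b a)"
    have vu: "adj v u" using uv adj_sym by simp
    have *: "(u \<in> beyond a b \<longleftrightarrow> v \<notin> beyond a b) \<longleftrightarrow> (u = a \<and> v = b \<or> u = b \<and> v = a)"
      if "adj a b" for a b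
      using crossing_edge[OF that uv] crossing_edge[OF that vu] end_in_beyond[OF that]
        start_notin_beyond[OF that] by blast
    show "(v \<in> beyond a b) \<longleftrightarrow> \<not> (v \<in> beyond b a)"
      using *[OF assms] *[OF ba] u by blast
  qed
  then show ?thesis using beyond_subset by blast
qed

end

section \<open>The Cayley tree of a free group\<close>

locale free_basis = group G for G (structure) +
  fixes S
  assumes free: "free_generating_set G S"
begin

definition letters :: "'a set" where
  "letters = S \<union> set_inv\<^bsub>G\<^esub> S"

definition adj :: "'a \<Rightarrow> 'a \<Rightarrow> bool" where
  "adj g h \<longleftrightarrow> g \<in> carrier G \<and> right_cayley_adj G S g h"

abbreviation word_prod :: "'a list \<Rightarrow> 'a" where
  "word_prod w \<equiv> foldr (\<otimes>) w \<one>"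

abbreviation reduced :: "'a list \<Rightarrow> bool" where
  "reduced w \<equiv> set w \<subseteq> letters \<and> successively (\<lambda>a b. b \<noteq> inv a) w"

lemma basis_closed: "S \<subseteq> carrier G"
  using free by (simp add: free_generating_set_def)

lemma letters_closed: "l \<in> letters \<Longrightarrow> l \<in> carrier G"
  using basis_closed by (auto simp: letters_def SET_INV_def)

lemma inv_letter: "l \<in> letters \<Longrightarrow> inv l \<in> letters"
  using basis_closed by (force simp: letters_def SET_INV_def)

lemma adj_iff: "adj g h \<longleftrightarrow> g \<in> carrier G \<and> (\<exists>l\<in>letters. h = g \<otimes> l)"
  by (simp add: adj_def right_cayley_adj_def letters_def)

lemma word_prod_closed: "set w \<subseteq> carrier G \<Longrightarrow> word_prod w \<in> carrier G"
  by (induction w) auto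

lemma word_prod_snoc:
  "set w \<subseteq> carrier G \<Longrightarrow> m \<in> carrier G \<Longrightarrow> word_prod (w @ [m]) = word_prod w \<otimes> m"
  by (induction w) (auto simp: m_assoc word_prod_closed simp del: foldr_append)

text \<open>\<open>reduced\<close> speaks of group elements, \<open>reduced_word\<close> of signed
  generators. The encoding \<open>enc\<close> has to choose a sign; two encoded letters with the
  same generator and opposite signs are always mutually inverse, so no cancellation is
  created.\<close>

lemma reduced_nontrivial:
  assumes "reduced w" "w \<noteq> []"
  shows "word_prod w \<noteq> \<one>"
proof -
  define enc where "enc l = (if l \<in> S then (l, True) else (inv l, False))" for l
  have enc: "fst (enc l) \<in> S \<and> (if snd (enc l) then fst (enc l) else inv (fst (enc l))) = l"
    if "l \<in> letters" for l
    using that basis_closed by (auto simp: enc_def letters_def SET_INV_def)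
  have "successively (\<lambda>a b. \<not> (fst (enc a) = fst (enc b) \<and> snd (enc a) \<noteq> snd (enc b))) w"
  proof (rule successively_mono)
    show "successively (\<lambda>a b. b \<noteq> inv a) w" using assms by simp
    fix a b assume ab: "a \<in> set w" "b \<in> set w" "b \<noteq> inv a"
    then have "a \<in> letters" "b \<in> letters" using assms by auto
    with ab(3) show "\<not> (fst (enc a) = fst (enc b) \<and> snd (enc a) \<noteq> snd (enc b))"
      using basis_closed by (auto simp: enc_def letters_def SET_INV_def split: if_splits)
  qed
  then have "reduced_word S (map enc w)"
    using assms enc by (auto simp: reduced_word_def successively_map case_prod_beta)
  moreover have "word_value G (map enc w) = word_prod w" if "set w \<subseteq> letters" for w
    using that by (induction w) (use enc in \<open>auto simp: word_value_def case_prod_beta\<close>)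
  ultimately show ?thesis
    using free assms unfolding free_generating_set_def by (metis Nil_is_map_conv)
qed

lemma letter_neq_one: "l \<in> letters \<Longrightarrow> l \<noteq> \<one>"
  using reduced_nontrivial[of "[l]"] letters_closed by auto

text \<open>An involution in \<open>S\<close> would make the square of a generator trivial. The word
  is given with signs because \<open>[l, l]\<close> is not \<open>reduced\<close> when
  \<open>l = inv l\<close>, so \<open>reduced_nontrivial\<close> says nothing about it.\<close>

lemma letter_neq_inv:
  assumes "l \<in> letters"
  shows "l \<noteq> inv l"
proof
  assume l: "l = inv l"
  obtain s where s: "s \<in> S" "inv s = s"
  proof (cases "l \<in> S")
    case True
    show ?thesis by (rule that[OF True l[symmetric]])
  next
    case False
    then obtain t where t: "t \<in> S" "l = inv t"
      using assms by (auto simp: letters_def SET_INV_def)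
    then have "inv l = t" using basis_closed by auto
    with t l have "inv t = t" by argo
    with t show ?thesis by (intro that)
  qed
  have "reduced_word S [(s, True), (s, True)]" using s(1) by (simp add: reduced_word_def)
  moreover have "word_value G [(s, True), (s, True)] = s \<otimes> s"
    using s(1) basis_closed by (auto simp: word_value_def)
  moreover have "s \<otimes> s = \<one>" using s(1) basis_closed r_inv[of s] unfolding s(2) by auto
  ultimately show False using free unfolding free_generating_set_def by (metis list.distinct(1))
qed

lemma reach_generated:
  assumes "x \<in> generate G S" "a \<in> carrier G"
  shows "reach adj (carrier G) a (a \<otimes> x)"
  using assms
proof (induction arbitrary: a rule: generate.induct)
  case (incl h)
  then have "h \<in> letters" by (simp add: letters_def)
  with incl show ?case by (intro reach_edge) (auto simp: adj_iff letters_closed)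
next
  case (inv h)
  then have "inv h \<in> letters" by (auto simp: letters_def SET_INV_def)
  with inv show ?case by (intro reach_edge) (auto simp: adj_iff letters_closed)
next
  case (eng h1 h2)
  have c: "h1 \<in> carrier G" "h2 \<in> carrier G"
    using eng.hyps generate_in_carrier[OF basis_closed] by auto
  from eng have "reach adj (carrier G) a (a \<otimes> h1)"
    "reach adj (carrier G) (a \<otimes> h1) (a \<otimes> h1 \<otimes> h2)" using c by auto
  then show ?case using c eng.prems by (auto simp: m_assoc intro: reach_trans)
qed auto

sublocale tree: tree_graph "carrier G" adj
proof
  show "a \<in> carrier G" if "adj a b" for a b using that by (simp add: adj_def)
  show "adj b a" if "adj a b" for a b
  proof -
    from that obtain l where l: "a \<in> carrier G" "l \<in> letters" "b = a \<otimes> l" by (auto simp: adj_iff)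
    then have "a = b \<otimes> inv l" using letters_closed by (simp add: m_assoc)
    moreover have "b \<in> carrier G" using l letters_closed by simp
    ultimately show ?thesis using inv_letter[OF l(2)] unfolding adj_iff by blast
  qed
  show "\<not> adj a a" for a
  proof
    assume "adj a a"
    then obtain l where "a \<in> carrier G" "l \<in> letters" "a = a \<otimes> l" by (auto simp: adj_iff)
    then have "l = \<one>" using letters_closed l_cancel_one' by blast
    then show False using letter_neq_one \<open>l \<in> letters\<close> by blast
  qed
  show "reach adj (carrier G) a b" if "a \<in> carrier G" "b \<in> carrier G" for a b
  proof -
    have "reach adj (carrier G) a (a \<otimes> (inv a \<otimes> b))"
      using free that by (intro reach_generated) (auto simp: free_generating_set_def)
    moreover have "a \<otimes> (inv a \<otimes> b) = b" using that by (simp add: m_assoc[symmetric])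
    ultimately show ?thesis by simp
  qed
  show "b = c" if "adj a b" "adj a c" and r: "reach adj (carrier G - {a}) b c" for a b c
  proof -
    obtain l where l: "a \<in> carrier G" "l \<in> letters" "b = a \<otimes> l" using \<open>adj a b\<close> by (auto simp: adj_iff)
    obtain m where m: "m \<in> letters" "c = a \<otimes> m" using \<open>adj a c\<close> by (auto simp: adj_iff)
    \<comment> \<open>Invariant for a walk that starts at \<open>b\<close> and avoids
      \<open>a\<close>: the position differs from \<open>a\<close> by a nonempty reduced word whose
      first letter is still \<open>l\<close>.\<close>
    define P where "P x \<longleftrightarrow> (\<exists>w. reduced w \<and> w \<noteq> [] \<and> hd w = l \<and> x = a \<otimes> word_prod w)" for x
    from r have "P c"
    proof (rule reach_invariant)
      show "P b" unfolding P_def using l letters_closed by (intro exI[of _ "[l]"]) auto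
      fix u v
      assume "adj u v" "v \<in> carrier G - {a}" "P u"
      then obtain w k where w: "reduced w" "w \<noteq> []" "hd w = l" "u = a \<otimes> word_prod w"
        and k: "k \<in> letters" "v = u \<otimes> k" by (auto simp: P_def adj_iff)
      have wc: "set w \<subseteq> carrier G" "k \<in> carrier G" using w k letters_closed by auto
      show "P v"
      proof (cases "k = inv (last w)")
        case False
        then have "reduced (w @ [k])" using w k by (auto simp: successively_append_iff)
        moreover have "v = a \<otimes> word_prod (w @ [k])"
          using w k wc l by (simp add: word_prod_snoc m_assoc word_prod_closed del: foldr_append)
        ultimately show ?thesis unfolding P_def using w by (intro exI[of _ "w @ [k]"]) auto
      next
        case True
        define w' where "w' = butlast w"
        have ww: "w = w' @ [last w]" using w by (simp add: w'_def)
        have c': "set w' \<subseteq> carrier G" "last w \<in> carrier G" using wc w ww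
          by (metis Un_subset_iff set_append) (use wc w in auto)
        have "word_prod w = word_prod w' \<otimes> last w"
          using word_prod_snoc[OF c'] ww by simp
        then have v: "v = a \<otimes> word_prod w'"
          using True k w l c' by (simp add: m_assoc word_prod_closed)
        \<comment> \<open>An empty word would mean that the walk has returned to the deleted vertex
          \<open>a\<close>.\<close>
        have "w' \<noteq> []" using v \<open>v \<in> carrier G - {a}\<close> l by auto
        moreover have "reduced w'" using w(1) by (subst (asm) (1 2) ww) (auto simp: successively_append_iff)
        moreover have "hd w' = l" using w(3) \<open>w' \<noteq> []\<close> ww by (metis hd_append2)
        ultimately show ?thesis unfolding P_def using v by blast
      qed
    qed
    then obtain w where w: "reduced w" "w \<noteq> []" "hd w = l" "c = a \<otimes> word_prod w"
      by (auto simp: P_def)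
    have wc: "set w \<subseteq> carrier G" using w letters_closed by auto
    have "m = word_prod w"
      using w(4) m l letters_closed word_prod_closed[OF wc] by simp
    \<comment> \<open>Both \<open>w\<close> and the single letter \<open>m\<close> lead from
      \<open>a\<close> to \<open>c\<close>. With different first letters, \<open>inv m # w\<close>
      would be a nonempty reduced word with value one.\<close>
    have "l = m"
    proof (rule ccontr)
      assume "l \<noteq> m"
      then have "reduced (inv m # w)"
        using w m letters_closed by (auto simp: inv_letter successively_Cons)
      then have "word_prod (inv m # w) \<noteq> \<one>" by (intro reduced_nontrivial) auto
      then show False using \<open>m = word_prod w\<close> m letters_closed by simp
    qed
    with l m show "b = c" by simp
  qed
qed

lemma adj_translate: "g \<in> carrier G \<Longrightarrow> adj a b \<Longrightarrow> adj (g \<otimes> a) (g \<otimes> b)"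
  using letters_closed by (auto simp: adj_iff m_assoc)

lemma reach_translate:
  assumes "g \<in> carrier G" "reach adj C a b"
  shows "reach adj ((\<otimes>) g ` C) (g \<otimes> a) (g \<otimes> b)"
  using assms(2) by (rule reach_map) (intro reach_edge adj_translate assms imageI)

lemma translate_beyond_subset:
  assumes "g \<in> carrier G" "a \<in> carrier G" "x \<in> tree.beyond a b"
  shows "g \<otimes> x \<in> tree.beyond (g \<otimes> a) (g \<otimes> b)"
proof -
  have x: "x \<in> carrier G" "reach adj (carrier G - {a}) x b"
    using assms by (auto simp: tree.beyond_def)
  have "(\<otimes>) g ` (carrier G - {a}) \<subseteq> carrier G - {g \<otimes> a}"
    using assms by auto
  with reach_translate[OF assms(1) x(2)] have "reach adj (carrier G - {g \<otimes> a}) (g \<otimes> x) (g \<otimes> b)"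
    by (rule reach_mono)
  then show ?thesis using x assms(1) by (simp add: tree.beyond_def)
qed

lemma translate_in_beyond_iff:
  assumes "g \<in> carrier G" "a \<in> carrier G" "b \<in> carrier G" "x \<in> carrier G"
  shows "g \<otimes> x \<in> tree.beyond (g \<otimes> a) (g \<otimes> b) \<longleftrightarrow> x \<in> tree.beyond a b"
proof
  have eq: "inv g \<otimes> (g \<otimes> y) = y" if "y \<in> carrier G" for y
    using that assms(1) by (simp flip: m_assoc)
  assume "g \<otimes> x \<in> tree.beyond (g \<otimes> a) (g \<otimes> b)"
  from translate_beyond_subset[OF inv_closed[OF assms(1)] m_closed[OF assms(1,2)] this]
  show "x \<in> tree.beyond a b" unfolding eq[OF assms(2)] eq[OF assms(3)] eq[OF assms(4)] .
qed (use assms translate_beyond_subset in blast)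

lemma successively_adj_iff:
  "set p \<subseteq> carrier G \<Longrightarrow> successively adj p \<longleftrightarrow> successively (right_cayley_adj G S) p"
  by (rule successively_cong) (auto simp: adj_def)

lemma ex_path_iff:
  assumes "g \<in> C" "C \<subseteq> carrier G"
  shows "(\<exists>p. right_cayley_path G S g p h \<and> set p \<subseteq> C) \<longleftrightarrow> reach adj C g h"
  unfolding reach_iff_path[OF assms(1)] right_cayley_path_def
  using assms(2) by (intro ex_cong1) (auto simp: successively_adj_iff)

text \<open>\<open>RPast\<close> quantifies over all paths to \<open>s\<close>, so its complement
  asks for one path that avoids the identity, which is reachability after deleting that
  vertex.\<close>

lemma RPast_eq:
  assumes "s \<in> letters"
  shows "RPast G S s = carrier G - tree.beyond \<one> s"
proof -
  have "adj \<one> s" using assms letters_closed by (auto simp: adj_iff)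
  have "(\<exists>p. right_cayley_path G S g p s \<and> \<one> \<notin> set p) \<longleftrightarrow> g \<in> tree.beyond \<one> s"
    if "g \<in> carrier G" for g
  \<comment> \<open>The deleted vertex itself is outside the range of
    \<open>ex_path_iff\<close>.\<close>
  proof (cases "g = \<one>")
    case True
    then show ?thesis
      using tree.start_notin_beyond[OF \<open>adj \<one> s\<close>] by (auto simp: right_cayley_path_def) (metis hd_in_set)
  next
    case False
    then show ?thesis
      using ex_path_iff[of g "carrier G - {\<one>}" s] that
      by (auto simp: tree.beyond_def right_cayley_path_def subset_Diff_insert)
  qed
  then show ?thesis by (auto simp: RPast_def tree.beyond_def)
qed

text \<open>From reachability to paths: if a path leaves \<open>D\<close> in its step from
  \<open>g\<close> to \<open>g'\<close>, its remainder avoids \<open>g\<close>, so its end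
  \<open>h\<close> lies behind that edge. But \<open>D\<close> is connected, contains
  \<open>g\<close> and misses \<open>g'\<close>, so by \<open>disjoint_beyond\<close> no element of
  \<open>D\<close> lies there.\<close>

lemma right_connected_iff:
  assumes "D \<subseteq> carrier G"
  shows "right_connected G S D \<longleftrightarrow> (\<forall>x\<in>D. \<forall>y\<in>D. reach adj D x y)"
proof (intro iffI ballI)
  fix x y
  assume D: "right_connected G S D" and xy: "x \<in> D" "y \<in> D"
  obtain p where "right_cayley_path G S x p y"
    using ex_path_iff[of x "carrier G" y] tree.reach_all[of x y] xy assms by blast
  then show "reach adj D x y"
    using ex_path_iff[of x D y] D xy assms by (auto simp: right_connected_def)
next
  assume D: "\<forall>x\<in>D. \<forall>y\<in>D. reach adj D x y"
  have "set p \<subseteq> D" if "right_cayley_path G S g p h" "g \<in> D" "h \<in> D" for g p h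
    using that
  proof (induction p arbitrary: g)
    case (Cons a p)
    then have [simp]: "a = g" by (simp add: right_cayley_path_def)
    show ?case
    proof (cases "p = []")
      case False
      define g' where "g' = hd p"
      have p: "right_cayley_path G S g' p h" "g \<notin> set p" "adj g g'"
        using Cons.prems False
        by (auto simp: right_cayley_path_def successively_Cons g'_def adj_def)
      have "g' \<in> D"
      proof (rule ccontr)
        assume "g' \<notin> D"
        then have "h \<notin> tree.beyond g g'"
          using tree.disjoint_beyond[OF p(3)] D Cons.prems by blast
        moreover have "reach adj (carrier G - {g}) g' h"
          using p tree.adj_irrefl tree.adj_in2[OF p(3)]
          by (subst ex_path_iff[symmetric]) (auto simp: right_cayley_path_def)
        then have "h \<in> tree.beyond g g'"
          using Cons.prems(3) assms tree.reach_commute by (auto simp: tree.beyond_def)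
        ultimately show False by simp
      qed
      from Cons.IH[OF p(1) this Cons.prems(3)] Cons.prems(2) show ?thesis by simp
    next
      case True
      with Cons.prems(2) show ?thesis by simp
    qed
  next
    case Nil
    then show ?case by simp
  qed
  then show "right_connected G S D" by (auto simp: right_connected_def)
qed

end

section \<open>Connected transversals and bases of subgroups\<close>

context free_basis begin

text \<open>Take a largest connected set containing the identity with at most one element in each
  coset; finite index bounds its size. If it missed a coset, some neighbour of it would lie in a
  missed coset and could be added.\<close>

lemma ex_connected_transversal:
  assumes H: "subgroup H G" and fin: "finite (rcosets H)"
  shows "\<exists>D. right_transversal G H D \<and> right_connected G S D \<and> \<one> \<in> D"
proof -
  have HG: "H \<subseteq> carrier G" using H by (rule subgroup.subset)
  define Q where "Q D \<longleftrightarrow> \<one> \<in> D \<and> D \<subseteq> carrier G \<and> (\<forall>x\<in>D. reach adj D \<one> x) \<and>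
    inj_on (\<lambda>d. H #> d) D" for D
  have coset: "H #> d \<in> rcosets H" if "d \<in> carrier G" for d
    using that HG by (intro rcosetsI)
  have img: "(\<lambda>d. H #> d) ` D \<subseteq> rcosets H" if "Q D" for D
    using that coset by (auto simp: Q_def)
  have bound: "finite D \<and> card D < Suc (card (rcosets H))" if "Q D" for D
  proof -
    have i: "inj_on (\<lambda>d. H #> d) D" using that by (simp add: Q_def)
    have "finite D" using finite_subset[OF img[OF that] fin] i by (rule finite_imageD)
    moreover have "card D = card ((\<lambda>d. H #> d) ` D)" using i by (simp add: card_image)
    ultimately show ?thesis using card_mono[OF fin img[OF that]] by simp
  qed
  have "Q {\<one>}" by (simp add: Q_def)
  then obtain D where D: "Q D" and max: "\<And>D'. Q D' \<Longrightarrow> card D' \<le> card D"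
    using ex_has_greatest_nat[of Q "{\<one>}" card "Suc (card (rcosets H))"] bound by blast
  have Dc: "D \<subseteq> carrier G" and inj: "inj_on (\<lambda>d. H #> d) D" using D by (auto simp: Q_def)
  have cover: "\<exists>d\<in>D. H #> g = H #> d" if "g \<in> carrier G" for g
  proof (rule reach_invariant[of adj "carrier G" \<one> g])
    show "reach adj (carrier G) \<one> g" using that by (intro tree.reach_all) auto
    show "\<exists>d\<in>D. H #> \<one> = H #> d" using D by (auto simp: Q_def)
    fix u v
    assume uv: "adj u v" "\<exists>d\<in>D. H #> u = H #> d"
    then obtain d l where d: "d \<in> D" "H #> u = H #> d" and l: "l \<in> letters" "v = u \<otimes> l"
      and u: "u \<in> carrier G" by (auto simp: adj_iff)
    have dl: "adj d (d \<otimes> l)" using d l Dc by (auto simp: adj_iff)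
    \<comment> \<open>Right multiplication acts on the right cosets, so \<open>v\<close> can be
      exchanged for a neighbour of \<open>d\<close> in the same coset.\<close>
    have eq: "H #> v = H #> (d \<otimes> l)"
      using coset_mult_assoc[OF HG] u d l letters_closed Dc by (metis subsetD)
    show "\<exists>d\<in>D. H #> v = H #> d"
    proof (rule ccontr)
      assume c: "\<not> ?thesis"
      define D' where "D' = insert (d \<otimes> l) D"
      have new: "d \<otimes> l \<notin> D" using c eq by auto
      have "reach adj D' \<one> x" if "x \<in> D" for x
        using D that by (auto simp: Q_def D'_def intro: reach_mono)
      moreover have "reach adj D' d (d \<otimes> l)" using dl d by (intro reach_edge) (auto simp: D'_def)
      ultimately have "\<forall>x\<in>D'. reach adj D' \<one> x" using d by (auto simp: D'_def intro: reach_trans)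
      moreover have "inj_on (\<lambda>d. H #> d) D'" using inj c eq new by (auto simp: D'_def)
      moreover have "D' \<subseteq> carrier G" using dl tree.adj_in2 Dc by (auto simp: D'_def)
      ultimately have "Q D'" using D by (auto simp: Q_def D'_def)
      then show False using max[of D'] new bound[OF D] by (simp add: D'_def)
    qed
  qed
  have "right_transversal G H D"
    unfolding right_transversal_def
  proof (intro conjI ballI Dc)
    fix C assume "C \<in> rcosets H"
    then obtain g where g: "g \<in> carrier G" "C = H #> g" by (auto simp: RCOSETS_def)
    with cover obtain d where d: "d \<in> D" "C = H #> d" by blast
    have eq: "C = H #> x" if "x \<in> C" for x
      using repr_independence[of x H g] that g H by simp
    show "\<exists>!d. d \<in> D \<inter> C"
    proof (rule ex1I)
      show "d \<in> D \<inter> C" using d Dc rcos_self[OF _ H] by auto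
      show "x = d" if "x \<in> D \<inter> C" for x
        using that eq[of x] d inj by (auto dest: inj_onD)
    qed
  qed
  moreover have "right_connected G S D"
    unfolding right_connected_iff[OF Dc]
    using D reach_trans[OF tree.reach_commute] unfolding Q_def by blast
  ultimately show ?thesis using D by (auto simp: Q_def)
qed

end

section \<open>Blocks of a connected transversal and the projection to the subgroup\<close>

locale connected_transversal = free_basis +
  fixes H D
  assumes subgroup: "subgroup H G"
    and transversal: "right_transversal G H D"
    and connected: "right_connected G S D"
    and one_in: "\<one> \<in> D"
begin

lemma H_closed: "h \<in> H \<Longrightarrow> h \<in> carrier G"
  by (rule subgroup.mem_carrier[OF subgroup])

lemma D_closed: "d \<in> D \<Longrightarrow> d \<in> carrier G"
  using transversal by (auto simp: right_transversal_def)

lemma reach_D: "x \<in> D \<Longrightarrow> y \<in> D \<Longrightarrow> reach adj D x y"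
  using connected right_connected_iff[OF subsetI[OF D_closed]] by simp

lemma finite_D:
  assumes "finite (rcosets H)"
  shows "finite D"
proof -
  have "inj_on (\<lambda>d. H #> d) D"
  proof (rule inj_onI)
    fix x y assume xy: "x \<in> D" "y \<in> D" "H #> x = H #> y"
    then have "x \<in> D \<inter> (H #> x)" "y \<in> D \<inter> (H #> x)"
      using rcos_self[OF _ subgroup] D_closed by auto
    moreover have "H #> x \<in> rcosets H"
      using xy D_closed subgroup.subset[OF subgroup] by (intro rcosetsI) auto
    ultimately show "x = y" using transversal unfolding right_transversal_def by blast
  qed
  moreover have "(\<lambda>d. H #> d) ` D \<subseteq> rcosets H"
    using D_closed subgroup.subset[OF subgroup] by (auto intro: rcosetsI)
  ultimately show ?thesis using assms finite_subset finite_imageD by blast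
qed

lemma ex1_decomposition:
  assumes "g \<in> carrier G"
  shows "\<exists>!h. h \<in> H \<and> inv h \<otimes> g \<in> D"
proof -
  have c: "H #> g \<in> rcosets H"
    using assms subgroup.subset[OF subgroup] by (intro rcosetsI) auto
  then obtain d where "d \<in> D" "d \<in> H #> g" using transversal unfolding right_transversal_def by blast
  then obtain k where k: "k \<in> H" "k \<otimes> g \<in> D" by (auto simp: r_coset_def)
  show ?thesis
  proof (rule ex1I)
    show "inv k \<in> H \<and> inv (inv k) \<otimes> g \<in> D"
      using k H_closed subgroup.m_inv_closed[OF subgroup] by auto
    fix h assume h: "h \<in> H \<and> inv h \<otimes> g \<in> D"
    then have "inv h \<otimes> g \<in> D \<inter> (H #> g)" "k \<otimes> g \<in> D \<inter> (H #> g)"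
      using k subgroup.m_inv_closed[OF subgroup] by (auto simp: r_coset_def)
    then have "inv h \<otimes> g = k \<otimes> g" using c transversal unfolding right_transversal_def by blast
    then have "inv h = k" using h k assms H_closed by simp
    then show "h = inv k" using h H_closed by auto
  qed
qed

text \<open>The contraction map of the tree: its fibre over \<open>h\<close> is the block
  \<open>h D\<close>, and by \<open>proj_mult\<close> it commutes with left translation by
  \<open>H\<close>.\<close>

definition proj :: "'a \<Rightarrow> 'a" where
  "proj g = (THE h. h \<in> H \<and> inv h \<otimes> g \<in> D)"

lemma proj_in: "g \<in> carrier G \<Longrightarrow> proj g \<in> H"
  and inv_proj_in: "g \<in> carrier G \<Longrightarrow> inv (proj g) \<otimes> g \<in> D"
  using theI'[OF ex1_decomposition] by (auto simp: proj_def)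

lemma proj_eqI: "g \<in> carrier G \<Longrightarrow> h \<in> H \<Longrightarrow> inv h \<otimes> g \<in> D \<Longrightarrow> proj g = h"
  using ex1_decomposition[of g] proj_in inv_proj_in by blast

lemma cancel_left: "h \<in> carrier G \<Longrightarrow> g \<in> carrier G \<Longrightarrow> inv h \<otimes> (h \<otimes> g) = g"
  and cancel_left': "h \<in> carrier G \<Longrightarrow> g \<in> carrier G \<Longrightarrow> h \<otimes> (inv h \<otimes> g) = g"
  by (simp_all flip: m_assoc)

lemma proj_mult_D: "h \<in> H \<Longrightarrow> d \<in> D \<Longrightarrow> proj (h \<otimes> d) = h"
  by (intro proj_eqI) (auto simp: cancel_left H_closed D_closed)

lemma proj_mult:
  assumes "h \<in> H" "g \<in> carrier G"
  shows "proj (h \<otimes> g) = h \<otimes> proj g"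
proof -
  define k where "k = proj g"
  have k: "k \<in> H" "inv k \<otimes> g \<in> D" using assms by (auto simp: k_def proj_in inv_proj_in)
  have "h \<otimes> g = (h \<otimes> k) \<otimes> (inv k \<otimes> g)"
    using k assms H_closed by (simp add: m_assoc cancel_left')
  then show ?thesis
    using proj_mult_D[OF subgroup.m_closed[OF subgroup assms(1) k(1)] k(2)] unfolding k_def by simp
qed

lemma proj_eq_one_iff: "g \<in> carrier G \<Longrightarrow> proj g = \<one> \<longleftrightarrow> g \<in> D"
  using proj_mult_D[of \<one> g] inv_proj_in[of g] subgroup.one_closed[OF subgroup] by auto

lemma in_block_iff:
  assumes "h \<in> H"
  shows "x \<in> (\<otimes>) h ` D \<longleftrightarrow> x \<in> carrier G \<and> proj x = h"
proof
  assume "x \<in> carrier G \<and> proj x = h"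
  then have "x = h \<otimes> (inv h \<otimes> x)" "inv h \<otimes> x \<in> D"
    using assms inv_proj_in H_closed by (auto simp: cancel_left')
  then show "x \<in> (\<otimes>) h ` D" by blast
qed (use assms in \<open>auto simp: proj_mult_D H_closed D_closed\<close>)

lemma reach_block:
  assumes "h \<in> H" "x \<in> (\<otimes>) h ` D" "y \<in> (\<otimes>) h ` D"
  shows "reach adj ((\<otimes>) h ` D) x y"
  using assms by (auto intro!: reach_translate reach_D H_closed)

section \<open>Edges leaving the block of the identity\<close>

definition exit_edge :: "'a \<Rightarrow> 'a \<Rightarrow> 'a \<Rightarrow> bool" where
  "exit_edge u a b \<longleftrightarrow> u \<noteq> \<one> \<and> a \<in> D \<and> adj a b \<and> proj b = u"

lemma exit_edgeD:
  assumes "exit_edge u a b"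
  shows "u \<noteq> \<one>" "u \<in> H" "a \<in> D" "adj a b" "proj b = u" "a \<in> carrier G" "b \<in> carrier G"
    "b \<notin> D" "b \<in> (\<otimes>) u ` D"
proof -
  show 1: "u \<noteq> \<one>" "a \<in> D" "adj a b" "proj b = u" using assms by (auto simp: exit_edge_def)
  then show 2: "a \<in> carrier G" "b \<in> carrier G" using tree.adj_in tree.adj_in2 by blast+
  then show "u \<in> H" "b \<notin> D" "b \<in> (\<otimes>) u ` D" using 1 proj_in proj_eq_one_iff in_block_iff by blast+
qed

lemma D_not_beyond:
  assumes "exit_edge u a b" "x \<in> D"
  shows "x \<notin> tree.beyond a b"
  using exit_edgeD[OF assms(1)] assms(2) by (intro tree.disjoint_beyond[of a b D] reach_D)

text \<open>The block of \<open>u\<close> is connected, contains \<open>b\<close> and misses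
  \<open>a\<close>, so it avoids the branch behind the reversed edge; \<open>beyond_swap\<close>
  puts it behind the edge itself.\<close>

lemma block_beyond:
  assumes e: "exit_edge u a b" and "x \<in> (\<otimes>) u ` D"
  shows "x \<in> tree.beyond a b"
proof -
  have ba: "adj b a" using exit_edgeD[OF e] tree.adj_sym by simp
  have "proj a = \<one>" using exit_edgeD[OF e] proj_eq_one_iff by simp
  then have "a \<notin> (\<otimes>) u ` D" using exit_edgeD[OF e] in_block_iff[of u a] by auto
  then have "x \<notin> tree.beyond b a"
    using reach_block[of u b x] exit_edgeD[OF e] assms(2) by (intro tree.disjoint_beyond[OF ba])
  moreover have "x \<in> carrier G" using assms exit_edgeD(2)[OF e] in_block_iff by blast
  ultimately show ?thesis using tree.beyond_swap[OF exit_edgeD(4)[OF e]] by blast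
qed

text \<open>A second edge would also start outside and end inside the branch of the first, and only
  one edge enters that branch.\<close>

lemma exit_edge_unique:
  assumes "exit_edge u a b" "exit_edge u a' b'"
  shows "a' = a \<and> b' = b"
proof (rule tree.crossing_edge)
  show "a' \<notin> tree.beyond a b" using D_not_beyond[OF assms(1)] exit_edgeD[OF assms(2)] by simp
  show "b' \<in> tree.beyond a b" using block_beyond[OF assms(1)] exit_edgeD[OF assms(2)] by simp
qed (use exit_edgeD[OF assms(1)] exit_edgeD[OF assms(2)] in auto)

text \<open>A walk inside the branch of \<open>u\<close> can enter the branch of \<open>u'\<close>
  only through \<open>a'\<close>, which lies in \<open>D\<close> and hence outside the branch of
  \<open>u\<close>.\<close>

lemma beyond_disjoint:
  assumes e: "exit_edge u a b" and e': "exit_edge u' a' b'" and "u \<noteq> u'"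
    and "x \<in> tree.beyond a b"
  shows "x \<notin> tree.beyond a' b'"
  using tree.reach_in_beyond[OF exit_edgeD(4)[OF e] assms(4)]
proof (rule reach_invariant)
  have neq: "b \<noteq> b'" using e e' \<open>u \<noteq> u'\<close> by (auto simp: exit_edge_def)
  show "b \<notin> tree.beyond a' b'"
    using tree.crossing_edge[OF exit_edgeD(4)[OF e'], of a b] exit_edgeD[OF e]
      D_not_beyond[OF e', of a] neq by blast
  fix v w
  assume vw: "adj v w" "v \<in> tree.beyond a b" "v \<notin> tree.beyond a' b'"
  have "v \<noteq> a'" using D_not_beyond[OF e] vw exit_edgeD[OF e'] by blast
  then show "w \<notin> tree.beyond a' b'"
    using tree.crossing_edge[OF exit_edgeD(4)[OF e'], of v w] vw by blast
qed

lemma exit_edge_inv: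
  assumes e: "exit_edge u a b"
  shows "exit_edge (inv u) (inv u \<otimes> b) (inv u \<otimes> a)"
proof -
  note E = exit_edgeD[OF e]
  have iu: "inv u \<in> H" using E subgroup.m_inv_closed[OF subgroup] by blast
  have "inv u \<otimes> b \<in> D" using E inv_proj_in by blast
  moreover have "adj (inv u \<otimes> b) (inv u \<otimes> a)"
    using E iu tree.adj_sym H_closed by (intro adj_translate)
  moreover have "proj (inv u \<otimes> a) = inv u" using iu E proj_mult_D by blast
  moreover have "inv u \<noteq> \<one>" using E H_closed by (metis inv_inv inv_one)
  ultimately show ?thesis by (simp add: exit_edge_def)
qed

text \<open>By uniqueness an involution would swap the ends of its exit edge. Writing
  \<open>b = a \<otimes> l\<close>, this forces \<open>l \<otimes> l = \<one>\<close>, against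
  \<open>letter_neq_inv\<close>.\<close>

lemma exit_edge_not_involution:
  assumes e: "exit_edge u a b"
  shows "inv u \<noteq> u"
proof
  note E = exit_edgeD[OF e]
  assume i: "inv u = u"
  with exit_edge_inv[OF e] have "exit_edge u (u \<otimes> b) (u \<otimes> a)" by simp
  from exit_edge_unique[OF e this] have ab: "u \<otimes> b = a" "u \<otimes> a = b" by auto
  obtain l where l: "l \<in> letters" "b = a \<otimes> l" using E by (auto simp: adj_iff)
  then have lc: "l \<in> carrier G" using letters_closed by simp
  have "a = u \<otimes> (a \<otimes> l)" using ab l by simp
  also have "\<dots> = b \<otimes> l" using ab E lc H_closed by (simp flip: m_assoc)
  also have "\<dots> = a \<otimes> (l \<otimes> l)" using l E lc by (simp add: m_assoc)
  finally have "l \<otimes> l = \<one>" using E lc by (metis l_cancel_one' m_closed)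
  then have "l = inv l" using lc by (metis inv_equality)
  with letter_neq_inv l show False by simp
qed

text \<open>Translation by \<open>u\<close> carries the exit edge of \<open>inv u\<close> to the
  reversed edge from \<open>b\<close> to \<open>a\<close>, and the complement of that branch is the
  branch behind the edge from \<open>a\<close> to \<open>b\<close>.\<close>

lemma translate_into_beyond:
  assumes e: "exit_edge u a b" and x: "x \<in> carrier G"
    and "x \<notin> tree.beyond (inv u \<otimes> b) (inv u \<otimes> a)"
  shows "u \<otimes> x \<in> tree.beyond a b"
proof -
  note E = exit_edgeD[OF e]
  have u: "u \<in> carrier G" using E H_closed by simp
  have "u \<otimes> x \<notin> tree.beyond b a"
    using translate_in_beyond_iff[of u "inv u \<otimes> b" "inv u \<otimes> a" x] assms E u
    by (simp add: cancel_left')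
  then show ?thesis using tree.beyond_swap[OF E(4)] u x by blast
qed

definition exits :: "'a set" where
  "exits = {u. \<exists>a b. exit_edge u a b}"

lemma exits_subset: "exits \<subseteq> H"
  using exit_edgeD(2) by (auto simp: exits_def)

lemma inv_exit: "u \<in> exits \<Longrightarrow> inv u \<in> exits"
  using exit_edge_inv unfolding exits_def by blast

text \<open>Translating the edge by \<open>inv (proj x)\<close> moves its start into
  \<open>D\<close>. Hence adjacent blocks differ by right multiplication with an exit.\<close>

lemma adj_proj:
  assumes "adj x y" "proj x \<noteq> proj y"
  shows "inv (proj x) \<otimes> proj y \<in> exits"
proof -
  define h where "h = proj x"
  have xy: "x \<in> carrier G" "y \<in> carrier G" using assms tree.adj_in tree.adj_in2 by blast+
  have h: "h \<in> H" "h \<in> carrier G" "inv h \<in> H"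
    using xy proj_in H_closed subgroup.m_inv_closed[OF subgroup] by (auto simp: h_def)
  have y: "proj y \<in> carrier G" using xy proj_in H_closed by blast
  have "inv h \<otimes> x \<in> D" using xy inv_proj_in by (simp add: h_def)
  moreover have "adj (inv h \<otimes> x) (inv h \<otimes> y)" using assms h by (intro adj_translate) auto
  moreover have "proj (inv h \<otimes> y) = inv h \<otimes> proj y" using h xy proj_mult by blast
  moreover have "inv h \<otimes> proj y \<noteq> \<one>"
    using assms(2) h y by (metis cancel_left' h_def r_one)
  ultimately show ?thesis unfolding exits_def exit_edge_def h_def by blast
qed

lemma ex_half_exits:
  assumes "countable (carrier G)"
  shows "\<exists>T. T \<union> (\<lambda>t. inv t) ` T = exits \<and> T \<inter> (\<lambda>t. inv t) ` T = {}"
proof -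
  define f where "f = to_nat_on (carrier G)"
  have inj: "inj_on f (carrier G)" using inj_on_to_nat_on[OF assms] unfolding f_def .
  \<comment> \<open>An enumeration of the countable group selects from each pair the element with
    the smaller index; ties are excluded because no exit is an involution.\<close>
  define T where "T = {u \<in> exits. f u < f (inv u)}"
  have c: "u \<in> carrier G" if "u \<in> exits" for u using that exits_subset H_closed by blast
  have lin: "f u < f (inv u) \<or> f (inv u) < f u" if "u \<in> exits" for u
  proof -
    have "inv u \<noteq> u" using that exit_edge_not_involution unfolding exits_def by blast
    then have "f (inv u) \<noteq> f u" using inj c[OF that] by (metis inj_onD inv_closed)
    then show ?thesis by linarith
  qed
  have "u \<in> T \<union> (\<lambda>t. inv t) ` T" if "u \<in> exits" for u
  proof (cases "f u < f (inv u)")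
    case False
    then have "inv u \<in> T" using lin[OF that] that inv_exit c[OF that] by (auto simp: T_def)
    moreover have "u = inv (inv u)" using c[OF that] by simp
    ultimately show ?thesis by blast
  qed (use that in \<open>auto simp: T_def\<close>)
  moreover have "T \<union> (\<lambda>t. inv t) ` T \<subseteq> exits" using inv_exit by (auto simp: T_def)
  moreover have "T \<inter> (\<lambda>t. inv t) ` T = {}" using c by (auto simp: T_def)
  ultimately show ?thesis by blast
qed

section \<open>Half of the exits is a free basis of the subgroup\<close>

context
  fixes T
  assumes T: "T \<union> (\<lambda>t. inv t) ` T = exits" "T \<inter> (\<lambda>t. inv t) ` T = {}"
begin

lemma half_subset: "T \<subseteq> H"
  using T exits_subset by blast

text \<open>Along a walk from the identity to \<open>g\<close>, \<open>proj\<close> is either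
  constant or multiplied on the right by an exit, so it stays in the generated subgroup. As the
  identity is in \<open>D\<close>, \<open>proj\<close> fixes every element of
  \<open>H\<close>.\<close>

lemma generate_half: "generate (G\<lparr>carrier := H\<rparr>) T = H"
proof -
  have "proj g \<in> generate G T" if "g \<in> carrier G" for g
  proof (rule reach_invariant[of adj "carrier G" \<one> g])
    show "reach adj (carrier G) \<one> g" using that by (intro tree.reach_all) auto
    have "proj \<one> = \<one>" using proj_eq_one_iff[of \<one>] one_in by simp
    then show "proj \<one> \<in> generate G T" by (simp add: generate.one)
    fix x y
    assume xy: "adj x y" "x \<in> carrier G" "y \<in> carrier G" "proj x \<in> generate G T"
    show "proj y \<in> generate G T"
    proof (cases "proj x = proj y")
      case False
      with xy adj_proj have "inv (proj x) \<otimes> proj y \<in> T \<union> (\<lambda>t. inv t) ` T" using T by blast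
      then have "inv (proj x) \<otimes> proj y \<in> generate G T"
        by (auto intro: generate.incl generate.inv)
      from generate.eng[OF xy(4) this] show ?thesis
        using xy proj_in H_closed by (simp add: cancel_left')
    qed (use xy in simp)
  qed
  then have "H \<subseteq> generate G T"
    using proj_mult_D[OF _ one_in] H_closed by (metis r_one subsetI)
  moreover have "generate G T \<subseteq> H"
    using generate_subgroup_incl half_subset subgroup by blast
  ultimately show ?thesis using generate_consistent[OF half_subset subgroup] by blast
qed

text \<open>Ping-pong: \<open>u\<close> maps the complement of the branch of \<open>inv u\<close> into the branch of \<open>u\<close>, and the
  branches of distinct exits are disjoint.\<close>

lemma word_value_beyond:
  assumes "reduced_word T w" "w \<noteq> []"
  shows "\<exists>a b. exit_edge (if snd (hd w) then fst (hd w) else inv (fst (hd w))) a b \<and>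
    word_value G w \<in> tree.beyond a b"
  using assms
proof (induction w)
  case (Cons c w)
  define u where "u = (if snd c then fst c else inv (fst c))"
  have c: "fst c \<in> T" using Cons.prems by (auto simp: reduced_word_def)
  then have "u \<in> exits" using T by (auto simp: u_def)
  then obtain a b where e: "exit_edge u a b" by (auto simp: exits_def)
  have val: "word_value G (c # w) = u \<otimes> word_value G w"
    by (simp add: word_value_def u_def case_prod_beta)
  \<comment> \<open>To apply the translation by \<open>u\<close>, the rest of the word must avoid
    the branch of \<open>inv u\<close>: an empty rest has its value in \<open>D\<close>, and a
    nonempty one has it in the branch of \<open>u'\<close>, which differs from
    \<open>inv u\<close>.\<close>
  have "word_value G w \<in> carrier G \<and> word_value G w \<notin> tree.beyond (inv u \<otimes> b) (inv u \<otimes> a)"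
  proof (cases "w = []")
    case True
    then have "word_value G w = \<one>" by (simp add: word_value_def)
    then show ?thesis using D_not_beyond[OF exit_edge_inv[OF e] one_in] by simp
  next
    case False
    define c' where "c' = hd w"
    define u' where "u' = (if snd c' then fst c' else inv (fst c'))"
    have c': "fst c' \<in> T" and nb: "\<not> (fst c = fst c' \<and> snd c \<noteq> snd c')"
      using Cons.prems False
      by (auto simp: reduced_word_def successively_Cons c'_def case_prod_beta)
    have "reduced_word T w" using Cons.prems by (auto simp: reduced_word_def successively_Cons)
    with Cons.IH False obtain a' b' where e': "exit_edge u' a' b'"
      and w: "word_value G w \<in> tree.beyond a' b'" unfolding u'_def c'_def by blast
    have cc: "fst c \<in> carrier G" "fst c' \<in> carrier G" using c c' half_subset H_closed by auto
    have disj: "inv t \<notin> T" if "t \<in> T" for t using T(2) that by blast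
    have "u' \<noteq> inv u"
    \<comment> \<open>With equal signs, equality would put a generator and its inverse into
      \<open>T\<close>; with opposite signs it would make the generators equal, contrary to
      reducedness.\<close>
    proof (cases "snd c = snd c'")
      case True
      have "fst c' \<noteq> inv (fst c)" using disj[OF c] c' by metis
      moreover have "inv (fst c') \<noteq> fst c" using disj[OF c'] c by metis
      ultimately show ?thesis using True cc by (auto simp: u_def u'_def)
    next
      case False
      then show ?thesis using nb cc inv_inv unfolding u_def u'_def by metis
    qed
    then show ?thesis
      using beyond_disjoint[OF e' exit_edge_inv[OF e] _ w] w tree.beyond_subset by blast
  qed
  then have "word_value G (c # w) \<in> tree.beyond a b"
    using translate_into_beyond[OF e] val by simp
  with e show ?case unfolding u_def list.sel by blast
qed simp

lemma half_free: "free_generating_set (G\<lparr>carrier := H\<rparr>) T"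
proof -
  have "word_value G w \<noteq> \<one>" if w: "reduced_word T w" "w \<noteq> []" for w
    using word_value_beyond[OF w] D_not_beyond[OF _ one_in] by metis
  moreover have "word_value (G\<lparr>carrier := H\<rparr>) w = word_value G w" if "reduced_word T w" for w
  proof -
    have "fst ` set w \<subseteq> H" using that half_subset by (auto simp: reduced_word_def)
    then show ?thesis
      by (induction w) (auto simp: word_value_def m_inv_consistent[OF subgroup])
  qed
  ultimately show ?thesis
    using half_subset generate_half by (auto simp: free_generating_set_def)
qed

lemma letters_half: "T \<union> set_inv\<^bsub>G\<lparr>carrier := H\<rparr>\<^esub> T = exits"
proof -
  have "set_inv\<^bsub>G\<lparr>carrier := H\<rparr>\<^esub> T = (\<lambda>t. inv t) ` T"
    using half_subset m_inv_consistent[OF subgroup] by (force simp: SET_INV_def)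
  then show ?thesis using T by simp
qed

text \<open>A walk from \<open>b\<close> to \<open>x\<close> inside the branch avoids
  \<open>D\<close>, so \<open>proj\<close> turns it into a walk in the Cayley tree of
  \<open>H\<close> from \<open>t\<close> to \<open>h\<close> that avoids the identity. That would
  put \<open>h\<close> on the far side of \<open>t\<close>. So the past in \<open>H\<close>
  translates into the past in \<open>G\<close> across the exit edge.\<close>

lemma RPast_half:
  assumes e: "exit_edge t a b" and h: "h \<in> RPast (G\<lparr>carrier := H\<rparr>) T t"
    and x: "x \<in> (\<otimes>) h ` D"
  shows "x \<notin> tree.beyond a b"
proof
  interpret H: free_basis "G\<lparr>carrier := H\<rparr>" T
    by (intro free_basis.intro free_basis_axioms.intro half_free subgroup.subgroup_is_group
        subgroup is_group)
  note E = exit_edgeD[OF e]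
  have lets: "H.letters = exits" using letters_half by (simp add: H.letters_def)
  have t: "t \<in> exits" using e by (auto simp: exits_def)
  have past: "h \<in> H" "h \<notin> H.tree.beyond \<one> t" using h H.RPast_eq[of t] t lets by auto
  assume "x \<in> tree.beyond a b"
  with E have "reach adj (tree.beyond a b) b x" by (intro tree.reach_in_beyond)
  then have "reach H.adj (H - {\<one>}) (proj b) (proj x)"
  proof (rule reach_map)
    fix u v assume uv: "adj u v" "u \<in> tree.beyond a b" "v \<in> tree.beyond a b"
    then have c: "u \<in> carrier G" "v \<in> carrier G" using tree.beyond_subset by auto
    have p: "proj u \<in> H - {\<one>}" "proj v \<in> H - {\<one>}"
      using uv c proj_in proj_eq_one_iff D_not_beyond[OF e] by auto
    show "reach H.adj (H - {\<one>}) (proj u) (proj v)"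
    proof (cases "proj u = proj v")
      case False
      have "proj v = proj u \<otimes> (inv (proj u) \<otimes> proj v)"
        using p H_closed by (simp add: cancel_left')
      then have "H.adj (proj u) (proj v)"
        using adj_proj[OF uv(1) False] p lets by (auto simp: H.adj_iff)
      then show ?thesis using p by (intro reach_edge)
    qed simp
  qed
  moreover have "proj x = h" using x past in_block_iff by blast
  ultimately have "reach H.adj (H - {\<one>}) t h" using E by simp
  then have "reach H.adj (H - {\<one>}) h t" by (rule H.tree.reach_commute)
  then have "h \<in> H.tree.beyond \<one> t" unfolding H.tree.beyond_def using past by simp
  with past show False by simp
qed

end

end

section \<open>Conditional expectations and joins of partitions\<close>

context prob_space begin

text \<open>Multiplication by the indicator of \<open>A\<close>, which is
  \<open>F\<close>-measurable, localises the conditional expectation to \<open>A\<close>; there the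
  hypothesis is exactly the integral condition that characterises the constant
  \<open>c\<close>.\<close>

lemma real_cond_exp_const_on:
  assumes sub: "subalgebra M F" and A: "A \<in> sets F" and B: "B \<in> sets M"
    and c: "\<And>W. W \<in> sets F \<Longrightarrow> measure M (W \<inter> A \<inter> B) = c * measure M (W \<inter> A)"
  shows "AE x in M. x \<in> A \<longrightarrow> real_cond_exp M F (indicat_real B) x = c"
proof -
  interpret F: finite_measure_subalgebra M F
    by unfold_locales (rule sub)
  have FM: "W \<in> sets M" if "W \<in> sets F" for W using sub that by (auto simp: subalgebra_def)
  note [measurable] = A B FM[OF A]
  have int: "integrable M (\<lambda>x. indicat_real A x * indicat_real B x)"
    by (subst indicator_inter_arith[symmetric]) (auto intro!: integrable_real_indicator simp: emeasure_eq_measure)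
  have "AE x in M. real_cond_exp M F (\<lambda>x. indicat_real A x * indicat_real B x) x =
      indicat_real A x * real_cond_exp M F (indicat_real B) x"
    using int by (intro F.real_cond_exp_mult) auto
  moreover have "AE x in M. real_cond_exp M F (\<lambda>x. indicat_real A x * indicat_real B x) x =
      c * indicat_real A x"
  proof (rule F.real_cond_exp_charact)
    fix W assume W: "W \<in> sets F"
    note [measurable] = FM[OF W]
    have "(\<integral>x\<in>W. indicat_real A x * indicat_real B x \<partial>M) = (\<integral>x. indicat_real (W \<inter> A \<inter> B) x \<partial>M)"
      unfolding set_lebesgue_integral_def
      by (intro Bochner_Integration.integral_cong) (auto simp: indicator_def)
    also have "\<dots> = c * measure M (W \<inter> A)"
      using c[OF W] by simp
    also have "\<dots> = c * (\<integral>x. indicat_real (W \<inter> A) x \<partial>M)" by simp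
    also have "\<dots> = (\<integral>x. c * indicat_real (W \<inter> A) x \<partial>M)" by simp
    also have "\<dots> = (\<integral>x\<in>W. c * indicat_real A x \<partial>M)"
      unfolding set_lebesgue_integral_def
      by (intro Bochner_Integration.integral_cong) (auto simp: indicator_def)
    finally show "(\<integral>x\<in>W. indicat_real A x * indicat_real B x \<partial>M) = (\<integral>x\<in>W. c * indicat_real A x \<partial>M)" .
  qed (use int in \<open>auto simp: emeasure_eq_measure\<close>)
  ultimately show ?thesis
    by eventually_elim (auto simp: indicator_def)
qed

lemma sigma_partition_Int:
  assumes "partition_on \<Omega> \<alpha>" "A \<in> \<alpha>" "W \<in> sigma_sets \<Omega> \<alpha>"
  shows "W \<inter> A = A \<or> W \<inter> A = {}"
  using assms(3)
proof (induction rule: sigma_sets.induct)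
  case (Basic W)
  then show ?case using assms(1,2) by (auto simp: partition_on_def disjoint_def)
next
  case (Compl W)
  moreover have "A \<subseteq> \<Omega>" using assms by (auto simp: partition_on_def)
  ultimately show ?case by blast
next
  case (Union W)
  then show ?case by blast
qed simp

lemma cond_exp_partition_const:
  assumes part: "countable_partition M \<alpha>" and A: "A \<in> \<alpha>" and B: "B \<in> sets M"
    and pos: "measure M A \<noteq> 0"
  shows "AE x in M. x \<in> A \<longrightarrow> real_cond_exp M (sigma (space M) \<alpha>) (indicat_real B) x =
    measure M (A \<inter> B) / measure M A"
proof (rule real_cond_exp_const_on)
  have \<alpha>: "\<alpha> \<subseteq> sets M" "\<alpha> \<subseteq> Pow (space M)" "partition_on (space M) \<alpha>"
    using part sets.sets_into_space by (auto simp: countable_partition_def)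
  show "subalgebra M (sigma (space M) \<alpha>)"
    using \<alpha> by (auto simp: subalgebra_def sets.sigma_sets_subset)
  show "A \<in> sets (sigma (space M) \<alpha>)" using A \<alpha> by auto
  fix W assume "W \<in> sets (sigma (space M) \<alpha>)"
  then have "W \<inter> A = A \<or> W \<inter> A = {}"
    using sigma_partition_Int[OF \<alpha>(3) A] \<alpha>(2) by simp
  then show "measure M (W \<inter> A \<inter> B) = measure M (A \<inter> B) / measure M A * measure M (W \<inter> A)"
    using pos by auto
qed (rule B)

text \<open>Both conditional expectations are constant on the pieces of the partition, so the Markov
  property can be read off the measures of finitely many sets at a time.\<close>

lemma cond_exp_partition_iff:
  assumes part: "countable_partition M \<alpha>" and sub: "subalgebra M F" and \<alpha>F: "\<alpha> \<subseteq> sets F"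
    and B: "B \<in> sets M"
  shows "(AE x in M. real_cond_exp M F (indicat_real B) x =
      real_cond_exp M (sigma (space M) \<alpha>) (indicat_real B) x) \<longleftrightarrow>
    (\<forall>A\<in>\<alpha>. \<forall>W\<in>sets F. measure M (W \<inter> A \<inter> B) * measure M A = measure M (W \<inter> A) * measure M (A \<inter> B))"
    (is "?ae \<longleftrightarrow> ?prod")
proof
  interpret F: finite_measure_subalgebra M F
    by unfold_locales (rule sub)
  have FM: "W \<in> sets M" if "W \<in> sets F" for W using sub that by (auto simp: subalgebra_def)
  assume ae: ?ae
  show ?prod
  proof (intro ballI)
    fix A W assume A: "A \<in> \<alpha>" and W: "W \<in> sets F"
    have [measurable]: "A \<in> sets F" "A \<in> sets M" "W \<in> sets M" "B \<in> sets M"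
      using A \<alpha>F FM W B by auto
    show "measure M (W \<inter> A \<inter> B) * measure M A = measure M (W \<inter> A) * measure M (A \<inter> B)"
    proof (cases "measure M A = 0")
      case True
      \<comment> \<open>On a null piece both sides of the product identity vanish, so no quotient is
        formed.\<close>
      then have "measure M (W \<inter> A) = 0"
        using finite_measure_mono[of "W \<inter> A" A] by (simp add: measure_le_0_iff)
      with True show ?thesis by simp
    next
      case False
      define c where "c = measure M (A \<inter> B) / measure M A"
      have "AE x in M. x \<in> W \<inter> A \<longrightarrow> real_cond_exp M F (indicat_real B) x = c"
        using ae cond_exp_partition_const[OF part A B False]
        unfolding c_def by eventually_elim auto
      then have "(\<integral>x\<in>W \<inter> A. real_cond_exp M F (indicat_real B) x \<partial>M) = (\<integral>x\<in>W \<inter> A. c \<partial>M)"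
        by (intro set_lebesgue_integral_cong_AE) auto
      also have "(\<integral>x\<in>W \<inter> A. real_cond_exp M F (indicat_real B) x \<partial>M) = (\<integral>x\<in>W \<inter> A. indicat_real B x \<partial>M)"
        using W by (intro F.real_cond_exp_intA[symmetric]) (auto simp: emeasure_eq_measure)
      also have "\<dots> = (\<integral>x. indicat_real (W \<inter> A \<inter> B) x \<partial>M)"
        unfolding set_lebesgue_integral_def
        by (intro Bochner_Integration.integral_cong) (auto simp: indicator_def)
      also have "\<dots> = measure M (W \<inter> A \<inter> B)" by simp
      also have "(\<integral>x\<in>W \<inter> A. c \<partial>M) = c * measure M (W \<inter> A)"
        by (simp add: set_lebesgue_integral_def)
      finally show ?thesis using False by (simp add: c_def)
    qed
  qed
next
  assume prod: ?prod
  have "AE x in M. x \<in> A \<longrightarrow> real_cond_exp M F (indicat_real B) x =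
      real_cond_exp M (sigma (space M) \<alpha>) (indicat_real B) x" if A: "A \<in> \<alpha>" for A
  proof (cases "measure M A = 0")
    case True
    have "A \<in> sets M" using A part by (auto simp: countable_partition_def)
    then have "AE x in M. x \<notin> A" using True
      by (intro AE_not_in) (simp add: null_sets_def emeasure_eq_measure)
    then show ?thesis by eventually_elim simp
  next
    case False
    have "AE x in M. x \<in> A \<longrightarrow> real_cond_exp M F (indicat_real B) x = measure M (A \<inter> B) / measure M A"
      using prod A False \<alpha>F
      by (intro real_cond_exp_const_on[OF sub _ B]) (auto simp: field_simps)
    with cond_exp_partition_const[OF part A B False] show ?thesis
      by eventually_elim auto
  qed
  \<comment> \<open>There are countably many pieces, so the exceptional sets have a null
    union.\<close>
  then have "AE x in M. \<forall>A\<in>\<alpha>. x \<in> A \<longrightarrow> real_cond_exp M F (indicat_real B) x =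
      real_cond_exp M (sigma (space M) \<alpha>) (indicat_real B) x"
    using part by (subst AE_ball_countable) (auto simp: countable_partition_def)
  with AE_space show ?ae
  proof eventually_elim
    case (elim x)
    then obtain A where "A \<in> \<alpha>" "x \<in> A"
      using part by (auto simp: countable_partition_def partition_on_def)
    with elim show ?case by blast
  qed
qed

end

section \<open>Measure preserving actions and translated partitions\<close>

locale pmp_system = group G + prob_space M for G (structure) and M :: "'x measure" +
  fixes \<phi> :: "'a \<Rightarrow> 'x \<Rightarrow> 'x"
  assumes pmp: "pmp_action G M \<phi>"
begin

sublocale action: group_action G "space M" \<phi>
  using pmp by (simp add: pmp_action_def)

lemma image_mult:
  assumes "g \<in> carrier G" "h \<in> carrier G" "A \<subseteq> space M"
  shows "\<phi> g ` \<phi> h ` A = \<phi> (g \<otimes> h) ` A"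
proof -
  have "\<phi> g (\<phi> h x) = \<phi> (g \<otimes> h) x" if "x \<in> A" for x
    using action.composition_rule[of x g h] assms that by auto
  then show ?thesis by (force simp: image_iff)
qed

lemma image_one: "A \<subseteq> space M \<Longrightarrow> \<phi> \<one> ` A = A"
  by (auto simp: action.id_eq_one[symmetric] subset_eq)

lemma image_subset: "g \<in> carrier G \<Longrightarrow> A \<subseteq> space M \<Longrightarrow> \<phi> g ` A \<subseteq> space M"
  using action.surj_prop by blast

lemma image_inv: "g \<in> carrier G \<Longrightarrow> A \<subseteq> space M \<Longrightarrow> \<phi> g ` \<phi> (inv g) ` A = A"
  by (simp add: image_mult image_one)

lemma image_Int:
  "g \<in> carrier G \<Longrightarrow> A \<subseteq> space M \<Longrightarrow> B \<subseteq> space M \<Longrightarrow> \<phi> g ` (A \<inter> B) = \<phi> g ` A \<inter> \<phi> g ` B"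
  by (rule inj_on_image_Int[OF action.inj_prop])

lemma image_INTER:
  assumes "g \<in> carrier G" "D \<noteq> {}" "\<And>d. d \<in> D \<Longrightarrow> B d \<subseteq> space M"
  shows "\<phi> g ` (\<Inter>d\<in>D. B d) = (\<Inter>d\<in>D. \<phi> g ` B d)"
proof -
  obtain d where "d \<in> D" using assms(2) by blast
  with assms show ?thesis by (intro image_INT[OF action.inj_prop]) auto
qed

text \<open>Translated pieces are images, whereas measurability and invariance of the measure are
  stated by preimages; the inverse element converts one into the other.\<close>

lemma image_eq_vimage:
  assumes "g \<in> carrier G" "A \<subseteq> space M"
  shows "\<phi> g ` A = \<phi> (inv g) -` A \<inter> space M"
proof -
  have 1: "\<phi> (inv g) (\<phi> g x) = x" if "x \<in> space M" for x
    using action.orbit_sym_aux[OF assms(1) that refl] .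
  have 2: "\<phi> g (\<phi> (inv g) x) = x" if "x \<in> space M" for x
    using action.orbit_sym_aux[OF inv_closed[OF assms(1)] that refl] assms(1) by simp
  show ?thesis
  proof (intro equalityI subsetI)
    fix y assume "y \<in> \<phi> g ` A"
    then show "y \<in> \<phi> (inv g) -` A \<inter> space M" using 1 assms(2) image_subset[OF assms] by auto
  next
    fix y assume "y \<in> \<phi> (inv g) -` A \<inter> space M"
    then show "y \<in> \<phi> g ` A" using 2[of y] by (intro image_eqI[of _ _ "\<phi> (inv g) y"]) auto
  qed
qed

lemma image_sets:
  assumes "g \<in> carrier G" "A \<in> sets M"
  shows "\<phi> g ` A \<in> sets M"
proof -
  have "\<phi> (inv g) \<in> measurable M M" using pmp assms by (simp add: pmp_action_def)
  then show ?thesis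
    using image_eq_vimage[OF assms(1) sets.sets_into_space[OF assms(2)]] measurable_sets assms by simp
qed

lemma measure_image:
  assumes "g \<in> carrier G" "A \<in> sets M"
  shows "measure M (\<phi> g ` A) = measure M A"
proof -
  have m: "\<phi> (inv g) \<in> measurable M M" and d: "distr M M (\<phi> (inv g)) = M"
    using pmp assms by (auto simp: pmp_action_def)
  have "measure M A = measure (distr M M (\<phi> (inv g))) A" by (simp add: d)
  also have "\<dots> = measure M (\<phi> (inv g) -` A \<inter> space M)" by (rule measure_distr[OF m assms(2)])
  finally show ?thesis
    using image_eq_vimage[OF assms(1) sets.sets_into_space[OF assms(2)]] by simp
qed

lemma image_sigma_sets:
  assumes g: "g \<in> carrier G" and \<A>: "\<A> \<subseteq> Pow (space M)" and W: "W \<in> sigma_sets (space M) \<A>"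
  shows "\<phi> g ` W \<in> sigma_sets (space M) ((`) (\<phi> g) ` \<A>)"
  using W
proof (induction rule: sigma_sets.induct)
  case (Compl W)
  have "W \<subseteq> space M" using sigma_sets_into_sp[OF \<A> Compl.hyps] .
  then have "\<phi> g ` (space M - W) = space M - \<phi> g ` W"
    using inj_on_image_set_diff[OF action.inj_prop[OF g], of "space M" W] action.surj_prop[OF g] by auto
  with Compl show ?case by (simp add: sigma_sets.Compl)
next
  case (Union W)
  then show ?case by (simp add: image_UN sigma_sets.Union)
qed (auto intro: sigma_sets.intros)

context
  fixes \<alpha> assumes part: "countable_partition M \<alpha>"
begin

lemma pieces_sets: "A \<in> \<alpha> \<Longrightarrow> A \<in> sets M"
  using part by (auto simp: countable_partition_def)

lemma pieces_subset: "A \<in> \<alpha> \<Longrightarrow> A \<subseteq> space M"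
  using pieces_sets sets.sets_into_space by blast

lemma generators_subset:
  "F \<subseteq> carrier G \<Longrightarrow> (\<Union>f\<in>F. translate \<phi> f \<alpha>) \<subseteq> sets M"
  using image_sets pieces_sets by (auto simp: translate_def)

lemma sets_join_algebra:
  assumes "F \<subseteq> carrier G"
  shows "sets (join_algebra M \<phi> F \<alpha>) = sigma_sets (space M) (\<Union>f\<in>F. translate \<phi> f \<alpha>)"
  using generators_subset[OF assms] sets.sets_into_space
  by (auto simp: join_algebra_def intro!: sets_measure_of)

lemma subalgebra_join_algebra:
  assumes "F \<subseteq> carrier G"
  shows "subalgebra M (join_algebra M \<phi> F \<alpha>)"
  unfolding subalgebra_def sets_join_algebra[OF assms]
  using sets.sigma_sets_subset[OF generators_subset[OF assms]] by (simp add: join_algebra_def space_measure_of_conv)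

lemma join_algebra_mono:
  assumes "F \<subseteq> F'" "F' \<subseteq> carrier G"
  shows "sets (join_algebra M \<phi> F \<alpha>) \<subseteq> sets (join_algebra M \<phi> F' \<alpha>)"
  using assms sets_join_algebra[of F] sets_join_algebra[of F'] by (auto intro!: sigma_sets_mono')

lemma image_in_join_algebra:
  "F \<subseteq> carrier G \<Longrightarrow> f \<in> F \<Longrightarrow> A \<in> \<alpha> \<Longrightarrow> \<phi> f ` A \<in> sets (join_algebra M \<phi> F \<alpha>)"
  by (auto simp: sets_join_algebra translate_def intro!: sigma_sets.Basic)

lemma pieces_in_join_algebra:
  assumes "F \<subseteq> carrier G" "\<one> \<in> F"
  shows "\<alpha> \<subseteq> sets (join_algebra M \<phi> F \<alpha>)"
  using image_in_join_algebra[OF assms] image_one pieces_subset by force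

lemma image_join_algebra:
  assumes g: "g \<in> carrier G" and F: "F \<subseteq> carrier G" and W: "W \<in> sets (join_algebra M \<phi> F \<alpha>)"
  shows "\<phi> g ` W \<in> sets (join_algebra M \<phi> ((\<otimes>) g ` F) \<alpha>)"
proof -
  have gF: "(\<otimes>) g ` F \<subseteq> carrier G" using g F by auto
  have "(`) (\<phi> g) ` translate \<phi> f \<alpha> = translate \<phi> (g \<otimes> f) \<alpha>" if "f \<in> F" for f
    unfolding translate_def image_image[of "(`) (\<phi> g)"]
    using image_mult[OF g _ pieces_subset] F that by (intro image_cong[OF refl]) blast
  then have "(`) (\<phi> g) ` (\<Union>f\<in>F. translate \<phi> f \<alpha>) = (\<Union>f\<in>(\<otimes>) g ` F. translate \<phi> f \<alpha>)"
    by (simp add: image_UN)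
  moreover have "(\<Union>f\<in>F. translate \<phi> f \<alpha>) \<subseteq> Pow (space M)"
    using generators_subset[OF F] sets.sets_into_space by blast
  ultimately show ?thesis
    using image_sigma_sets[OF g, of "\<Union>f\<in>F. translate \<phi> f \<alpha>" W] W
    by (simp add: sets_join_algebra[OF F] sets_join_algebra[OF gF])
qed

lemma translate_partition:
  assumes "g \<in> carrier G"
  shows "partition_on (space M) (translate \<phi> g \<alpha>)"
proof -
  have p: "partition_on (space M) \<alpha>" using part by (simp add: countable_partition_def)
  show ?thesis
  proof (rule partition_onI)
    show "\<Union> (translate \<phi> g \<alpha>) = space M"
      using p action.surj_prop[OF assms] unfolding partition_on_def translate_def
      by (metis image_Union)
    fix P Q assume "P \<in> translate \<phi> g \<alpha>" "Q \<in> translate \<phi> g \<alpha>" "P \<noteq> Q"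
    then obtain A B where AB: "A \<in> \<alpha>" "B \<in> \<alpha>" "P = \<phi> g ` A" "Q = \<phi> g ` B" "A \<noteq> B"
      by (auto simp: translate_def)
    then have "A \<inter> B = {}" using p by (auto simp: partition_on_def disjoint_def)
    then show "disjnt P Q"
      using AB image_Int[OF assms, of A B] pieces_subset by (simp add: disjnt_def)
  next
    show "{} \<notin> translate \<phi> g \<alpha>" using p by (auto simp: translate_def partition_on_def)
  qed
qed

context
  fixes D assumes D: "finite D" "D \<noteq> {}" "D \<subseteq> carrier G"
begin

text \<open>\<open>common_refinement\<close> chooses one set for each partition, not for each
  \<open>d\<close>; translates by different \<open>d\<close> may coincide as partitions. The choice
  is reindexed here by group elements.\<close>

lemma join_pieceE:
  assumes "C \<in> join_partition \<phi> D \<alpha>"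
  obtains A where "\<And>d. d \<in> D \<Longrightarrow> A d \<in> \<alpha>" "C = (\<Inter>d\<in>D. \<phi> d ` A d)"
proof -
  obtain f where f: "\<And>d. d \<in> D \<Longrightarrow> f (translate \<phi> d \<alpha>) \<in> translate \<phi> d \<alpha>"
    and C: "C = \<Inter> (f ` (\<lambda>d. translate \<phi> d \<alpha>) ` D)"
    using assms by (auto simp: join_partition_def common_refinement)
  from f have "\<forall>d\<in>D. \<exists>A\<in>\<alpha>. f (translate \<phi> d \<alpha>) = \<phi> d ` A" by (force simp: translate_def)
  then obtain A where A: "\<forall>d\<in>D. A d \<in> \<alpha> \<and> f (translate \<phi> d \<alpha>) = \<phi> d ` A d" by metis
  show thesis
  proof (rule that)
    show "C = (\<Inter>d\<in>D. \<phi> d ` A d)" using C A by auto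
  qed (use A in auto)
qed

lemma join_piece_in_algebra:
  assumes "C \<in> join_partition \<phi> D \<alpha>"
  shows "C \<in> sets (join_algebra M \<phi> D \<alpha>)"
proof -
  obtain A where A: "\<And>d. d \<in> D \<Longrightarrow> A d \<in> \<alpha>" and C: "C = (\<Inter>d\<in>D. \<phi> d ` A d)"
    by (rule join_pieceE[OF assms]) blast
  show ?thesis unfolding C
    using D image_in_join_algebra[OF D(3)] A by (intro sets.finite_INT) auto
qed

text \<open>Join pieces come from choices of one piece in each of finitely many countable
  partitions, so there are countably many of them.\<close>

lemma countable_partition_join: "countable_partition M (join_partition \<phi> D \<alpha>)"
proof -
  have "partition_on (space M) (join_partition \<phi> D \<alpha>)"
    unfolding join_partition_def using D translate_partition
    by (intro partition_on_common_refinement) auto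
  moreover have "countable (join_partition \<phi> D \<alpha>)"
  proof -
    have "countable (translate \<phi> d \<alpha>)" for d
      using part by (auto simp: translate_def countable_partition_def)
    then have "countable (\<Pi>\<^sub>E P\<in>(\<lambda>d. translate \<phi> d \<alpha>) ` D. P)"
      using D by (intro countable_PiE) auto
    then show ?thesis
      unfolding join_partition_def common_refinement_def by (intro countable_Diff countable_UN) auto
  qed
  moreover have "join_partition \<phi> D \<alpha> \<subseteq> sets M"
    using join_piece_in_algebra subalgebra_join_algebra[OF D(3)] by (auto simp: subalgebra_def)
  ultimately show ?thesis by (simp add: countable_partition_def)
qed

text \<open>Each join piece lies in a single piece of the translate by \<open>d\<close>, so the
  given set is the countable union of the join pieces inside it.\<close>

lemma image_in_sigma_join:
  assumes "d \<in> D" "A \<in> \<alpha>"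
  shows "\<phi> d ` A \<in> sigma_sets (space M) (join_partition \<phi> D \<alpha>)"
proof -
  define \<C> where "\<C> = {C \<in> join_partition \<phi> D \<alpha>. C \<subseteq> \<phi> d ` A}"
  have cp: "partition_on (space M) (join_partition \<phi> D \<alpha>)" "countable (join_partition \<phi> D \<alpha>)"
    using countable_partition_join by (auto simp: countable_partition_def)
  have dis: "disjoint (translate \<phi> d \<alpha>)"
    using translate_partition assms D by (auto simp: partition_on_def)
  have "x \<in> \<Union> \<C>" if x: "x \<in> \<phi> d ` A" for x
  proof -
    have "x \<in> space M" using x assms D image_subset pieces_subset by blast
    then obtain C where C: "C \<in> join_partition \<phi> D \<alpha>" "x \<in> C"
      using cp by (auto simp: partition_on_def)
    have d: "translate \<phi> d \<alpha> \<in> (\<lambda>d. translate \<phi> d \<alpha>) ` D" using assms by blast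
    obtain B where B: "B \<in> \<alpha>" "C \<subseteq> \<phi> d ` B"
      using common_refinement_exists[OF C(1)[unfolded join_partition_def] d] by (auto simp: translate_def)
    have "\<phi> d ` B = \<phi> d ` A"
    proof (rule ccontr)
      assume "\<phi> d ` B \<noteq> \<phi> d ` A"
      then have "\<phi> d ` B \<inter> \<phi> d ` A = {}"
        using assms B by (intro disjointD[OF dis]) (auto simp: translate_def)
      with x B C show False by blast
    qed
    with B C show ?thesis by (auto simp: \<C>_def)
  qed
  then have "\<phi> d ` A = \<Union> \<C>" by (auto simp: \<C>_def)
  moreover have "\<Union> \<C> \<in> sigma_sets (space M) (join_partition \<phi> D \<alpha>)"
  proof (rule sigma_sets_UNION)
    show "countable \<C>" using cp by (auto simp: \<C>_def)
  qed (auto simp: \<C>_def)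
  ultimately show ?thesis by simp
qed

end

end

lemma pmp_subgroup:
  assumes "subgroup H G"
  shows "pmp_action (G\<lparr>carrier := H\<rparr>) M \<phi>"
proof -
  have H: "H \<subseteq> carrier G" using assms by (rule subgroup.subset)
  have "group_action (G\<lparr>carrier := H\<rparr>) (space M) \<phi>"
    unfolding group_action_def group_hom_def group_hom_axioms_def
    using action.group_hom subgroup.subgroup_is_group[OF assms is_group] H
    by (auto simp: group_hom_def group_hom_axioms_def hom_def Pi_iff subset_iff)
  then show ?thesis using pmp H by (auto simp: pmp_action_def)
qed

end

section \<open>Markov processes\<close>

locale markov_tree = free_basis G S + pmp_system G M \<phi>
  for G (structure) and S and M :: "'x measure" and \<phi> +
  fixes \<alpha>
  assumes markov: "markov_process_wrt G M \<phi> S \<alpha>"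
begin

lemma sigma_sets_subset_join_algebra:
  assumes "\<A> \<subseteq> sets (join_algebra M \<phi> F \<gamma>)"
  shows "sigma_sets (space M) \<A> \<subseteq> sets (join_algebra M \<phi> F \<gamma>)"
proof -
  have "space (join_algebra M \<phi> F \<gamma>) = space M"
    by (simp add: join_algebra_def space_measure_of_conv)
  with sets.sigma_sets_subset[OF assms] show ?thesis by simp
qed

lemma part: "countable_partition M \<alpha>"
  using markov by (simp add: markov_process_wrt_def)

abbreviation alg :: "'a set \<Rightarrow> 'x set set" where
  "alg F \<equiv> sets (join_algebra M \<phi> F \<alpha>)"

lemma alg_sets: "F \<subseteq> carrier G \<Longrightarrow> W \<in> alg F \<Longrightarrow> W \<in> sets M"
  using subalgebra_join_algebra[OF part] by (auto simp: subalgebra_def)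

lemma piece_image_sets: "g \<in> carrier G \<Longrightarrow> A \<in> \<alpha> \<Longrightarrow> \<phi> g ` A \<in> sets M"
  using image_sets pieces_sets[OF part] by blast

lemma markov_letter:
  assumes l: "l \<in> letters" and A: "A \<in> \<alpha>" "A' \<in> \<alpha>"
    and W: "W \<in> alg (carrier G - tree.beyond \<one> l)"
  shows "measure M (W \<inter> A \<inter> \<phi> l ` A') * measure M A = measure M (W \<inter> A) * measure M (A \<inter> \<phi> l ` A')"
proof -
  let ?F = "carrier G - tree.beyond \<one> l"
  have one: "\<one> \<in> ?F" using tree.start_notin_beyond[of \<one> l] l letters_closed by (auto simp: adj_iff)
  have "AE x in M. real_cond_exp M (join_algebra M \<phi> ?F \<alpha>) (indicat_real (\<phi> l ` A')) x =
      real_cond_exp M (sigma (space M) \<alpha>) (indicat_real (\<phi> l ` A')) x"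
    using markov l A(2) unfolding markov_process_wrt_def RPast_eq[OF l, symmetric] letters_def by blast
  then show ?thesis
    using cond_exp_partition_iff[OF part subalgebra_join_algebra[OF part, of ?F]
        pieces_in_join_algebra[OF part _ one]] piece_image_sets[OF letters_closed[OF l] A(2)] A(1) W
    by auto
qed

text \<open>Translation by \<open>inv a\<close> preserves the measure and the tree and carries the
  edge to one that starts at the identity, where \<open>markov_letter\<close> applies.\<close>

lemma markov_edge:
  assumes ab: "adj a b" and A: "A \<in> \<alpha>" "A' \<in> \<alpha>"
    and W: "W \<in> alg (carrier G - tree.beyond a b)"
  shows "measure M (W \<inter> \<phi> a ` A \<inter> \<phi> b ` A') * measure M (\<phi> a ` A) =
    measure M (W \<inter> \<phi> a ` A) * measure M (\<phi> a ` A \<inter> \<phi> b ` A')"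
proof -
  obtain l where l: "l \<in> letters" "b = a \<otimes> l" and a: "a \<in> carrier G" using ab by (auto simp: adj_iff)
  have lc: "l \<in> carrier G" using l letters_closed by simp
  define V where "V = \<phi> (inv a) ` W"
  have "(\<otimes>) (inv a) ` (carrier G - tree.beyond a b) \<subseteq> carrier G - tree.beyond \<one> l"
  proof (rule image_subsetI)
    fix x assume x: "x \<in> carrier G - tree.beyond a b"
    moreover have "a \<otimes> (inv a \<otimes> x) = x" using a x by (simp flip: m_assoc)
    ultimately have "a \<otimes> (inv a \<otimes> x) \<notin> tree.beyond (a \<otimes> \<one>) (a \<otimes> l)"
      using a l(2) by simp
    then show "inv a \<otimes> x \<in> carrier G - tree.beyond \<one> l"
      using translate_in_beyond_iff[OF a one_closed lc, of "inv a \<otimes> x"] x a by simp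
  qed
  from join_algebra_mono[OF part this Diff_subset] image_join_algebra[OF part inv_closed[OF a] Diff_subset W]
  have V: "V \<in> alg (carrier G - tree.beyond \<one> l)" unfolding V_def by (rule subsetD)
  have Ws: "W \<in> sets M" by (rule alg_sets[OF Diff_subset W])
  have Vs: "V \<in> sets M" unfolding V_def using image_sets[OF inv_closed[OF a] Ws] .
  have sp: "A \<subseteq> space M" "A' \<subseteq> space M" "V \<subseteq> space M" "W \<subseteq> space M"
    using A pieces_subset[OF part] Vs Ws by (simp_all add: sets.sets_into_space)
  have sets: "A \<in> sets M" "\<phi> l ` A' \<in> sets M"
    using A pieces_sets[OF part] piece_image_sets[OF lc] by simp_all
  have lsp: "\<phi> l ` A' \<subseteq> space M" by (rule sets.sets_into_space[OF sets(2)])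
  have eqs: "\<phi> a ` V = W" "\<phi> b ` A' = \<phi> a ` \<phi> l ` A'"
    unfolding V_def using image_inv[OF a sp(4)] image_mult[OF a lc sp(2)] l(2) by simp_all
  have VA: "V \<inter> A \<subseteq> space M" using sp by blast
  have "W \<inter> \<phi> a ` A \<inter> \<phi> b ` A' = \<phi> a ` (V \<inter> A \<inter> \<phi> l ` A')"
    "W \<inter> \<phi> a ` A = \<phi> a ` (V \<inter> A)" "\<phi> a ` A \<inter> \<phi> b ` A' = \<phi> a ` (A \<inter> \<phi> l ` A')"
    unfolding eqs(2) image_Int[OF a VA lsp] image_Int[OF a sp(3,1)] image_Int[OF a sp(1) lsp] eqs(1)
    by (rule refl)+
  then show ?thesis
    using markov_letter[OF l(1) A V]
    by (simp only: measure_image[OF a] sets Vs sets.Int)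
qed

text \<open>The Markov property across an edge, extended from the far endpoint to a finite connected set
  behind it: each new vertex sees the old ones and the past only through its neighbour.\<close>

lemma markov_branch:
  assumes ab: "adj a b" and D: "finite D" "a \<in> D" "D \<subseteq> insert a (tree.beyond a b)"
    and conn: "\<And>x. x \<in> D \<Longrightarrow> reach adj D a x" and A: "\<And>g. g \<in> D \<Longrightarrow> A g \<in> \<alpha>"
    and W: "W \<in> alg (carrier G - tree.beyond a b)"
  shows "measure M (W \<inter> (\<Inter>g\<in>D. \<phi> g ` A g)) * measure M (\<phi> a ` A a) =
    measure M (W \<inter> \<phi> a ` A a) * measure M (\<Inter>g\<in>D. \<phi> g ` A g)"
  using D(1,2) conn
proof (rule finite_connected_induct)
  fix E g h
  assume E: "a \<in> E" "E \<subseteq> D" "\<And>x. x \<in> E \<Longrightarrow> reach adj E a x"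
    and IH: "measure M (W \<inter> (\<Inter>g\<in>E. \<phi> g ` A g)) * measure M (\<phi> a ` A a) =
      measure M (W \<inter> \<phi> a ` A a) * measure M (\<Inter>g\<in>E. \<phi> g ` A g)"
    and gh: "g \<in> E" "h \<in> D - E" "adj g h"
  define P where "P = carrier G - tree.beyond a b"
  \<comment> \<open>All vertices in play before \<open>h\<close> is added. This set is connected,
    contains \<open>g\<close> and misses \<open>h\<close>, hence lies on the near side of the edge
    from \<open>g\<close> to \<open>h\<close>.\<close>
  define C where "C = E \<union> P"
  define B where "B = (\<Inter>g\<in>E. \<phi> g ` A g)"
  have a: "a \<in> carrier G" using ab tree.adj_in by blast
  have Dc: "D \<subseteq> carrier G" using D(3) a tree.beyond_subset by blast
  have "h \<in> tree.beyond a b" using gh D(3) E(1) by auto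
  then have "h \<notin> C" using gh by (simp add: C_def P_def)
  have ba: "adj b a" using ab tree.adj_sym by simp
  have reach: "reach adj C a x" if "x \<in> C" for x
  proof (cases "x \<in> E")
    case False
    then have "x \<in> tree.beyond b a" using that tree.beyond_swap[OF ab] by (simp add: C_def P_def)
    then have "reach adj (tree.beyond b a) a x" by (rule tree.reach_in_beyond[OF ba])
    then show ?thesis
      by (rule reach_mono) (use tree.beyond_swap[OF ab] in \<open>auto simp: C_def P_def\<close>)
  next
    case True
    from E(3)[OF this] show ?thesis by (rule reach_mono) (simp add: C_def)
  qed
  have sub: "C \<subseteq> carrier G - tree.beyond g h"
  proof
    fix x assume x: "x \<in> C"
    have "reach adj C g a" by (rule tree.reach_commute, rule reach) (simp add: C_def gh)
    then have "reach adj C g x" using reach[OF x] by (rule reach_trans)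
    then have "x \<notin> tree.beyond g h" by (rule tree.disjoint_beyond[OF gh(3) \<open>h \<notin> C\<close>])
    then show "x \<in> carrier G - tree.beyond g h" using x E Dc by (auto simp: C_def P_def)
  qed
  let ?Q = "carrier G - tree.beyond g h"
  have "alg P \<subseteq> alg ?Q" using sub by (intro join_algebra_mono[OF part]) (auto simp: C_def)
  then have WQ: "W \<in> alg ?Q" using W by (auto simp: P_def)
  have "finite E" "E \<noteq> {}" using D(1) E(1,2) by (auto intro: finite_subset)
  moreover have "\<phi> x ` A x \<in> alg ?Q" if "x \<in> E" for x
    using that sub E(2) A by (intro image_in_join_algebra[OF part]) (auto simp: C_def)
  ultimately have BQ: "B \<in> alg ?Q" unfolding B_def by (intro sets.finite_INT) auto
  have Ag: "A g \<in> \<alpha>" "A h \<in> \<alpha>" using A gh E by auto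
  have Bg: "B \<inter> \<phi> g ` A g = B" "W \<inter> B \<inter> \<phi> g ` A g = W \<inter> B" using gh by (auto simp: B_def)
  define q where "q = measure M (\<phi> g ` A g \<inter> \<phi> h ` A h)"
  define p where "p = measure M (\<phi> g ` A g)"
  \<comment> \<open>Adding \<open>h\<close> multiplies the measure by the same factor
    \<open>q / p\<close> with the past event \<open>W\<close> and without it.\<close>
  have 1: "measure M (W \<inter> B \<inter> \<phi> h ` A h) * p = measure M (W \<inter> B) * q"
    using markov_edge[OF gh(3) Ag sets.Int[OF WQ BQ]] unfolding Bg p_def q_def .
  have 2: "measure M (B \<inter> \<phi> h ` A h) * p = measure M B * q"
    using markov_edge[OF gh(3) Ag BQ] unfolding Bg p_def q_def .
  have ins: "(\<Inter>g\<in>insert h E. \<phi> g ` A g) = B \<inter> \<phi> h ` A h" by (auto simp: B_def)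
  have Bs: "B \<in> sets M" using alg_sets[OF _ BQ] by auto
  have gc: "g \<in> carrier G" using gh E Dc by auto
  have hs: "\<phi> h ` A h \<in> sets M" using gh Dc Ag by (intro piece_image_sets) auto
  have Ws: "W \<in> sets M" using alg_sets[OF _ WQ] by auto
  show "measure M (W \<inter> (\<Inter>g\<in>insert h E. \<phi> g ` A g)) * measure M (\<phi> a ` A a) =
    measure M (W \<inter> \<phi> a ` A a) * measure M (\<Inter>g\<in>insert h E. \<phi> g ` A g)"
  proof (cases "p = 0")
    case True
    \<comment> \<open>If the piece at \<open>g\<close> is null, both sides vanish, because
      \<open>g\<close> belongs to \<open>E\<close>.\<close>
    have "measure M X = 0" if "X \<subseteq> \<phi> g ` A g" for X
      using finite_measure_mono[OF that] piece_image_sets[OF gc Ag(1)] True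
      by (simp add: p_def measure_le_0_iff)
    moreover have "B \<inter> \<phi> h ` A h \<subseteq> \<phi> g ` A g" "W \<inter> (B \<inter> \<phi> h ` A h) \<subseteq> \<phi> g ` A g"
      using gh by (auto simp: B_def)
    ultimately show ?thesis unfolding ins by simp
  next
    case False
    have "measure M (W \<inter> B \<inter> \<phi> h ` A h) * measure M (\<phi> a ` A a) * p =
        (measure M (W \<inter> B \<inter> \<phi> h ` A h) * p) * measure M (\<phi> a ` A a)"
      by simp
    also have "\<dots> = (measure M (W \<inter> B) * measure M (\<phi> a ` A a)) * q"
      unfolding 1 by simp
    also have "\<dots> = measure M (W \<inter> \<phi> a ` A a) * (measure M B * q)"
      unfolding B_def IH by (rule mult.assoc)
    also have "\<dots> = measure M (W \<inter> \<phi> a ` A a) * measure M (B \<inter> \<phi> h ` A h) * p"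
      unfolding 2[symmetric] by (rule mult.assoc[symmetric])
    finally show ?thesis using False unfolding ins by (simp add: Int_assoc)
  qed
qed auto

end

section \<open>The Markov property of the join under the subgroup\<close>

locale markov_transversal = markov_tree G S M \<phi> \<alpha> + connected_transversal G S H D
  for G (structure) and S and M :: "'x measure" and \<phi> \<alpha> H D +
  assumes finite_index: "finite (rcosets H)"
begin

abbreviation \<beta> :: "'x set set" where
  "\<beta> \<equiv> join_partition \<phi> D \<alpha>"

lemma D_props: "finite D" "D \<noteq> {}" "D \<subseteq> carrier G"
  using finite_D[OF finite_index] one_in D_closed by auto

lemmas part_join = countable_partition_join[OF part D_props]

lemma block_subset: "h \<in> H \<Longrightarrow> (\<otimes>) h ` D \<subseteq> carrier G"
  using H_closed D_closed by auto

lemma join_algebra_join_subset: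
  assumes "K \<subseteq> H"
  shows "sets (join_algebra M \<phi> K \<beta>) \<subseteq> alg (\<Union>h\<in>K. (\<otimes>) h ` D)"
proof -
  have K: "K \<subseteq> carrier G" and KD: "(\<Union>h\<in>K. (\<otimes>) h ` D) \<subseteq> carrier G"
    using assms H_closed block_subset by blast+
  have "\<phi> h ` C \<in> alg (\<Union>h\<in>K. (\<otimes>) h ` D)" if "h \<in> K" "C \<in> \<beta>" for h C
    using image_join_algebra[OF part _ D_props(3) join_piece_in_algebra[OF part D_props that(2)]]
      join_algebra_mono[OF part _ KD, of "(\<otimes>) h ` D"] that K by blast
  then have "sigma_sets (space M) (\<Union>h\<in>K. translate \<phi> h \<beta>) \<subseteq> alg (\<Union>h\<in>K. (\<otimes>) h ` D)"
    by (intro sigma_sets_subset_join_algebra) (auto simp: translate_def)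
  then show ?thesis using sets_join_algebra[OF part_join K] by simp
qed

text \<open>Every \<open>g\<close> factors as \<open>h \<otimes> d\<close> with \<open>h\<close> in
  \<open>H\<close> and \<open>d\<close> in \<open>D\<close>, and the translate of a piece by
  \<open>d\<close> is a union of pieces of \<beta>. This makes \<beta> generating for
  \<open>H\<close>.\<close>

lemma join_algebra_subset_join: "alg (carrier G) \<subseteq> sets (join_algebra M \<phi> H \<beta>)"
proof -
  have HG: "H \<subseteq> carrier G" using H_closed by auto
  have \<beta>: "\<beta> \<subseteq> Pow (space M)" using pieces_subset[OF part_join] by auto
  have "\<phi> g ` A \<in> sets (join_algebra M \<phi> H \<beta>)" if g: "g \<in> carrier G" and A: "A \<in> \<alpha>" for g A
  proof -
    define h where "h = proj g"
    define d where "d = inv h \<otimes> g"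
    have h: "h \<in> H" "h \<in> carrier G" and d: "d \<in> D"
      using g proj_in inv_proj_in H_closed by (auto simp: h_def d_def)
    have "\<phi> g ` A = \<phi> h ` \<phi> d ` A"
      using g h d D_closed pieces_subset[OF part A] by (simp add: image_mult d_def cancel_left')
    also have "\<dots> \<in> sigma_sets (space M) (translate \<phi> h \<beta>)"
      using image_sigma_sets[OF h(2) \<beta> image_in_sigma_join[OF part D_props d A]]
      by (simp add: translate_def)
    also have "\<dots> \<subseteq> sigma_sets (space M) (\<Union>h\<in>H. translate \<phi> h \<beta>)"
      using h by (intro sigma_sets_mono') auto
    also have "\<dots> = sets (join_algebra M \<phi> H \<beta>)" using sets_join_algebra[OF part_join HG] by simp
    finally show ?thesis .
  qed
  then have "sigma_sets (space M) (\<Union>g\<in>carrier G. translate \<phi> g \<alpha>) \<subseteq> sets (join_algebra M \<phi> H \<beta>)"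
    by (intro sigma_sets_subset_join_algebra) (auto simp: translate_def)
  then show ?thesis using sets_join_algebra[OF part, of "carrier G"] by simp
qed

lemma generating_join: "generating_partition (G\<lparr>carrier := H\<rparr>) M \<phi> \<beta>"
proof -
  have "\<exists>C \<in> sets (join_algebra M \<phi> H \<beta>). (B - C) \<union> (C - B) \<in> null_sets M"
    if B: "B \<in> sets M" for B
  proof -
    obtain C where "C \<in> alg (carrier G)" and null: "(B - C) \<union> (C - B) \<in> null_sets M"
      using markov B unfolding markov_process_wrt_def generating_partition_def by blast
    then have "C \<in> sets (join_algebra M \<phi> H \<beta>)" using join_algebra_subset_join by blast
    with null show ?thesis by blast
  qed
  then show ?thesis by (simp add: generating_partition_def)
qed

text \<open>The whole block of \<open>t\<close> lies behind the edge from \<open>a\<close> to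
  \<open>b\<close>, so it sees the past only through the piece at \<open>a\<close>. The piece
  \<open>C\<close> fixes that piece and lies in the past, so conditioning on \<open>C\<close> yields
  the same probability as conditioning on the piece at \<open>a\<close> alone.\<close>

lemma markov_exit:
  assumes e: "exit_edge t a b" and P: "P \<subseteq> H" "\<one> \<in> P"
    and past: "\<And>h x. h \<in> P \<Longrightarrow> x \<in> (\<otimes>) h ` D \<Longrightarrow> x \<notin> tree.beyond a b"
    and B: "B \<in> \<beta>" and C: "C \<in> \<beta>" and W: "W \<in> sets (join_algebra M \<phi> P \<beta>)"
  shows "measure M (W \<inter> C \<inter> \<phi> t ` B) * measure M C = measure M (W \<inter> C) * measure M (C \<inter> \<phi> t ` B)"
proof -
  note E = exit_edgeD[OF e]
  have t: "t \<in> carrier G" using E H_closed by simp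
  obtain A where A: "\<And>d. d \<in> D \<Longrightarrow> A d \<in> \<alpha>" and BA: "B = (\<Inter>d\<in>D. \<phi> d ` A d)"
    by (rule join_pieceE[OF part D_props B]) blast
  obtain A' where A': "\<And>d. d \<in> D \<Longrightarrow> A' d \<in> \<alpha>" and CA: "C = (\<Inter>d\<in>D. \<phi> d ` A' d)"
    by (rule join_pieceE[OF part D_props C]) blast
  \<comment> \<open>The tree passed to \<open>markov_branch\<close> is the block of \<open>t\<close>
    with \<open>a\<close> attached: \<open>a\<close> is labelled as in \<open>C\<close>, and
    \<open>t \<otimes> d\<close> as \<open>d\<close> is in \<open>B\<close>.\<close>
  define R where "R g = (if g = a then A' a else A (inv t \<otimes> g))" for g
  define N where "N = insert a ((\<otimes>) t ` D)"
  have "proj a \<noteq> t" using E proj_eq_one_iff by metis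
  then have a: "a \<notin> (\<otimes>) t ` D" using E in_block_iff by blast
  have "\<phi> t ` B = (\<Inter>d\<in>D. \<phi> t ` \<phi> d ` A d)"
    unfolding BA using t D_props A D_closed image_subset pieces_subset[OF part]
    by (intro image_INTER) auto
  also have "\<dots> = (\<Inter>d\<in>D. \<phi> (t \<otimes> d) ` R (t \<otimes> d))"
  proof (rule INF_cong[OF refl])
    fix d assume d: "d \<in> D"
    then have "t \<otimes> d \<noteq> a" using a by blast
    then have "R (t \<otimes> d) = A d" using d t D_closed by (simp add: R_def cancel_left)
    then show "\<phi> t ` \<phi> d ` A d = \<phi> (t \<otimes> d) ` R (t \<otimes> d)"
      using d t D_closed A pieces_subset[OF part] by (simp add: image_mult)
  qed
  finally have N: "(\<Inter>g\<in>N. \<phi> g ` R g) = \<phi> a ` A' a \<inter> \<phi> t ` B"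
    by (simp add: N_def R_def)
  have conn: "reach adj N a x" if "x \<in> N" for x
  proof (cases "x = a")
    case False
    then have "x \<in> (\<otimes>) t ` D" using that by (simp add: N_def)
    then have "reach adj ((\<otimes>) t ` D) b x" using E by (intro reach_block)
    then have "reach adj N b x" by (rule reach_mono) (auto simp: N_def)
    moreover have "reach adj N a b" using E by (intro reach_edge) (auto simp: N_def)
    ultimately show ?thesis by (blast intro: reach_trans)
  qed simp
  have R: "R g \<in> \<alpha>" if "g \<in> N" for g
    using that E A A' t D_closed by (auto simp: N_def R_def cancel_left)
  have Nsub: "N \<subseteq> insert a (tree.beyond a b)" using block_beyond[OF e] by (auto simp: N_def)
  have "(\<Union>h\<in>P. (\<otimes>) h ` D) \<subseteq> carrier G - tree.beyond a b"
    using past P block_subset by blast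
  then have sub: "sets (join_algebra M \<phi> P \<beta>) \<subseteq> alg (carrier G - tree.beyond a b)"
    using order_trans[OF join_algebra_join_subset[OF P(1)] join_algebra_mono[OF part]] by simp
  have PG: "P \<subseteq> carrier G" using P H_closed by auto
  have CP: "C \<in> sets (join_algebra M \<phi> P \<beta>)"
    using pieces_in_join_algebra[OF part_join PG P(2)] C by auto
  have key: "measure M (X \<inter> \<phi> t ` B) * measure M (\<phi> a ` A' a) =
      measure M X * measure M (\<phi> a ` A' a \<inter> \<phi> t ` B)"
    if X: "X \<in> sets (join_algebra M \<phi> P \<beta>)" "X \<subseteq> \<phi> a ` A' a" for X
  proof -
    have XN: "X \<inter> (\<phi> a ` A' a \<inter> \<phi> t ` B) = X \<inter> \<phi> t ` B" "X \<inter> \<phi> a ` A' a = X" using X by auto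
    have Ra: "R a = A' a" by (simp add: R_def)
    have fin: "finite N" "a \<in> N" using D_props by (auto simp: N_def)
    have "X \<in> alg (carrier G - tree.beyond a b)" using X sub by blast
    from markov_branch[of a b N R X, OF E(4) fin Nsub conn R this] show ?thesis unfolding N Ra XN by simp
  qed
  have Ca: "C \<subseteq> \<phi> a ` A' a" using E by (auto simp: CA)
  define p where "p = measure M (\<phi> a ` A' a)"
  define q where "q = measure M (\<phi> a ` A' a \<inter> \<phi> t ` B)"
  \<comment> \<open>With \<open>X = W \<inter> C\<close> and with \<open>X = C\<close> the
    conditional probability is the same quotient \<open>q / p\<close>; comparing the two eliminates
    it.\<close>
  have 1: "measure M (W \<inter> C \<inter> \<phi> t ` B) * p = measure M (W \<inter> C) * q"
    unfolding p_def q_def using W CP Ca by (intro key) auto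
  have 2: "measure M (C \<inter> \<phi> t ` B) * p = measure M C * q"
    unfolding p_def q_def using CP Ca by (intro key) auto
  show ?thesis
  proof (cases "p = 0")
    case True
    have "measure M X = 0" if "X \<subseteq> \<phi> a ` A' a" for X
      using finite_measure_mono[OF that] piece_image_sets[OF E(6) A'[OF E(3)]] True
      by (simp add: p_def measure_le_0_iff)
    then show ?thesis using Ca by (simp add: le_infI2)
  next
    case False
    have "measure M (W \<inter> C \<inter> \<phi> t ` B) * measure M C * p =
        measure M (W \<inter> C \<inter> \<phi> t ` B) * p * measure M C" by simp
    also have "\<dots> = measure M (W \<inter> C) * (measure M C * q)" unfolding 1 by simp
    also have "\<dots> = measure M (W \<inter> C) * measure M (C \<inter> \<phi> t ` B) * p"
      unfolding 2[symmetric] by simp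
    finally show ?thesis using False by simp
  qed
qed

theorem markov_subgroup:
  assumes "countable (carrier G)"
  shows "\<exists>T. free_generating_set (G\<lparr>carrier := H\<rparr>) T \<and>
    markov_process_wrt (G\<lparr>carrier := H\<rparr>) M \<phi> T \<beta>"
proof -
  obtain T where T: "T \<union> (\<lambda>t. inv t) ` T = exits" "T \<inter> (\<lambda>t. inv t) ` T = {}"
    using ex_half_exits[OF assms] by blast
  let ?P = "\<lambda>t. RPast (G\<lparr>carrier := H\<rparr>) T t"
  have P: "?P t \<subseteq> H" "\<one> \<in> ?P t" for t
    using subgroup.one_closed[OF subgroup] by (auto simp: RPast_def right_cayley_path_def) (metis hd_in_set)
  have "AE x in M. real_cond_exp M (join_algebra M \<phi> (?P t) \<beta>) (indicat_real (\<phi> t ` B)) x =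
      real_cond_exp M (sigma (space M) \<beta>) (indicat_real (\<phi> t ` B)) x"
    if t: "t \<in> exits" and B: "B \<in> \<beta>" for t B
  proof -
    obtain a b where e: "exit_edge t a b" using t by (auto simp: exits_def)
    have tc: "t \<in> carrier G" using t exits_subset H_closed by auto
    have PG: "?P t \<subseteq> carrier G" using P H_closed by blast
    show ?thesis
      by (subst cond_exp_partition_iff[OF part_join subalgebra_join_algebra[OF part_join PG]
            pieces_in_join_algebra[OF part_join PG P(2)] image_sets[OF tc pieces_sets[OF part_join B]]])
        (intro ballI markov_exit[OF e P RPast_half[OF T e] B])
  qed
  then have "markov_process_wrt (G\<lparr>carrier := H\<rparr>) M \<phi> T \<beta>"
    unfolding markov_process_wrt_def letters_half[OF T]
    using pmp_subgroup[OF subgroup] half_free[OF T] part_join generating_join by blast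
  with half_free[OF T] show ?thesis by blast
qed

end

theorem theorem5p1:
  fixes G :: "('g, 'm) monoid_scheme"
    and H :: "'g set"
    and M :: "'x measure"
    and \<phi> :: "'g \<Rightarrow> 'x \<Rightarrow> 'x"
  assumes "free_group G"
    and "countable (carrier G)"
    and "standard_probability_space M"
    and "pmp_action G M \<phi>"
    and "subgroup H G"
    and "finite (rcosets\<^bsub>G\<^esub> H)"
  shows "((\<exists>S \<alpha>. markov_process_wrt G M \<phi> S \<alpha> \<and> shannon_entropy M \<alpha> < \<infinity>) \<longrightarrow>
            markov_process (G\<lparr>carrier := H\<rparr>) M \<phi>) \<and>
         (\<forall>S \<alpha> \<Delta>. markov_process_wrt G M \<phi> S \<alpha> \<and> shannon_entropy M \<alpha> < \<infinity> \<and>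
            right_transversal G H \<Delta> \<and> right_connected G S \<Delta> \<and> \<one>\<^bsub>G\<^esub> \<in> \<Delta> \<longrightarrow>
            (\<exists>T. free_generating_set (G\<lparr>carrier := H\<rparr>) T \<and>
                 markov_process_wrt (G\<lparr>carrier := H\<rparr>) M \<phi> T (join_partition \<phi> \<Delta> \<alpha>)))"
proof -
  have G: "group G" using assms(1) by (simp add: free_group_def)
  have M: "prob_space M" using assms(3) by (simp add: standard_probability_space_def)
  have basis: "free_basis G S" if "markov_process_wrt G M \<phi> S \<alpha>" for S \<alpha>
    using that G by (simp add: free_basis_def free_basis_axioms_def markov_process_wrt_def)
  have main: "\<exists>T. free_generating_set (G\<lparr>carrier := H\<rparr>) T \<and>
      markov_process_wrt (G\<lparr>carrier := H\<rparr>) M \<phi> T (join_partition \<phi> \<Delta> \<alpha>)"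
    if "markov_process_wrt G M \<phi> S \<alpha>" "right_transversal G H \<Delta>" "right_connected G S \<Delta>"
      "\<one>\<^bsub>G\<^esub> \<in> \<Delta>" for S \<alpha> \<Delta>
  proof -
    note fb = basis[OF that(1)]
    have "pmp_system G M \<phi>" using G M assms(4) by (intro pmp_system.intro pmp_system_axioms.intro)
    then have mt: "markov_tree G S M \<phi> \<alpha>"
      by (rule markov_tree.intro[OF fb _ markov_tree_axioms.intro[OF that(1)]])
    have ct: "connected_transversal G S H \<Delta>"
      by (rule connected_transversal.intro[OF fb connected_transversal_axioms.intro[OF assms(5) that(2-4)]])
    interpret markov_transversal G S M \<phi> \<alpha> H \<Delta>
      by (rule markov_transversal.intro[OF mt ct markov_transversal_axioms.intro[OF assms(6)]])
    show ?thesis using assms(2) by (rule markov_subgroup)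
  qed
  have "markov_process (G\<lparr>carrier := H\<rparr>) M \<phi>" if m: "markov_process_wrt G M \<phi> S \<alpha>" for S \<alpha>
  proof -
    \<comment> \<open>A connected transversal turns the explicit statement into the existence of a
      Markov partition for \<open>H\<close>.\<close>
    obtain \<Delta> where "right_transversal G H \<Delta>" "right_connected G S \<Delta>" "\<one>\<^bsub>G\<^esub> \<in> \<Delta>"
      using free_basis.ex_connected_transversal[OF basis[OF m] assms(5,6)] by blast
    from main[OF m this] show ?thesis unfolding markov_process_def by blast
  qed
  then show ?thesis using main by (intro conjI impI allI; elim exE conjE) assumption+
qed

end
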